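(* Let $\nu>0$, $b\ge 0$, $a,c\in\mathbb{R}$, $x_0^2:=a^2+4\nu b$, and let $k_m\ge 0$, $\omega_m>0$ be fixed. For a mesh size $h>0$ and time step $\Delta t>0$ put $k_M=\pi/h$, $\omega_M=\pi/\Delta t$, and $D=\{(\omega,k):\omega_m\le|\omega|\le\omega_M,\ k_m\le|k|\le k_M\}$. Assume either $\Delta t=C_h h$ or $\Delta t=C_h h^2$ for a fixed constant $C_h>0$. Then for small $h$ and small $\Delta t$ the Robin best approximation problem with $L=0$, $$\inf_{p\in\mathbb{C}}\sup_{(\omega,k)\in D}|\rho(\omega,k,p,0,0)|,$$ has a unique solution $(p_0^*(0),\delta_0^*(0))$ (minimizer and minimal value), which is given asymptotically by $$p_0^*(0)\sim\sqrt{\frac{A}{Bh}},\qquad \delta_0^*(0)\sim 1-\frac12\sqrt{ABh},$$ where $A$ is the constant defined in the context and $$B=\begin{cases}\dfrac{2}{\nu\pi}&\text{if }\Delta t=C_h h,\\[2mm] C\dfrac{\sqrt{2d}}{\nu\pi}&\text{if }\Delta t=C_h h^2,\end{cases}\qquad d:=\nu\pi C_h,\quad C=\begin{cases}1&\text{if }d<d_0,\\ \sqrt{\dfrac{d+\sqrt{1+d^2}}{1+d^2}}&\text{if }d\ge d_0,\end{cases}$$ with $d_0\approx 1.543679$ the unique real root of $d^3-2d^2+2d-2$.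
   Context: This concerns the optimized Schwarz waveform relaxation algorithm for $\partial_t u+(a,c)\cdot\nabla u-\nu\Delta u+bu=f$ on $\mathbb{R}^2$, decomposed into $\Omega_1=(-\infty,L)\times\mathbb{R}$ and $\Omega_2=(0,\infty)\times\mathbb{R}$ ($L\ge0$ the overlap), with transmission operators $(\nu\nabla-\tfrac{(a,c)^T}{2})\cdot n_i+\tfrac{s}{2}$, $s=p+q(\partial_t+c\partial_y-\nu\Delta_y)$; after Fourier transform in $t$ (variable $\omega$) and $y$ (variable $k$) its convergence factor is $$\rho(\omega,k,p,q,L)=\frac{p+q(\nu k^2+i(\omega+ck))-\sqrt{x_0^2+4\nu(\nu k^2+i(\omega+ck))}}{p+q(\nu k^2+i(\omega+ck))+\sqrt{x_0^2+4\nu(\nu k^2+i(\omega+ck))}}\,e^{-\frac{L}{2\nu}\sqrt{x_0^2+4\nu(\nu k^2+i(\omega+ck))}},$$ where $\sqrt{\cdot}$ is the branch with positive real part. The Robin case is $q=0$. Define $$\bar k=|c|\frac{\sqrt{(c^2+x_0^2)^2+16\nu^2\omega_m^2}-(c^2+x_0^2)}{8\nu^2\omega_m},\qquad \varphi(k,\xi)=2\sqrt2\sqrt{\sqrt{(x_0^2+4\nu^2k^2)^2+16\nu^2\xi^2}+x_0^2+4\nu^2k^2},$$ and $A=\varphi(\bar k,-\omega_m+|c|\bar k)$ if $k_m\le\bar k$; $A=\varphi(k_m,-\omega_m+|c|k_m)$ if $\bar k\le k_m\le\omega_m/|c|$; $A=\varphi(k_m,0)$ if $k_m\ge\omega_m/|c|$.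 Standing assumption: either $x_0^2+4\nu^2k_m^2\neq0$ or $\omega_m\ne0$. The symbol $\sim$ denotes asymptotic equivalence (ratio tending to $1$) as $h\to0$. *)

theory Defs
  imports Complex_Main "HOL-Library.Extended_Real"
begin

definition x0sq :: "real \<Rightarrow> real \<Rightarrow> real \<Rightarrow> real" where
  "x0sq \<nu> a b = a\<^sup>2 + 4 * \<nu> * b"

text \<open>Convergence factor rho(omega,k,p,q,L). csqrt is the principal branch (Re >= 0,
  and Re > 0 off the non-positive real axis, which the argument never meets on D).\<close>
definition rho :: "real \<Rightarrow> real \<Rightarrow> real \<Rightarrow> real \<Rightarrow> real \<Rightarrow> real \<Rightarrow> complex \<Rightarrow> complex \<Rightarrow> real \<Rightarrow> complex" where
  "rho \<nu> a b c \<omega> k p q L =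
    (let s = complex_of_real (\<nu> * k\<^sup>2) + \<i> * complex_of_real (\<omega> + c * k);
         r = csqrt (complex_of_real (x0sq \<nu> a b) + complex_of_real (4 * \<nu>) * s)
     in (p + q * s - r) / (p + q * s + r) * exp (- complex_of_real (L / (2 * \<nu>)) * r))"

definition dt :: "bool \<Rightarrow> real \<Rightarrow> real \<Rightarrow> real" where
  "dt quad Ch h = (if quad then Ch * h\<^sup>2 else Ch * h)"

definition freq_dom :: "bool \<Rightarrow> real \<Rightarrow> real \<Rightarrow> real \<Rightarrow> real \<Rightarrow> (real \<times> real) set" where
  "freq_dom quad Ch km \<omega>m h =
     {(\<omega>, k). \<omega>m \<le> \<bar>\<omega>\<bar> \<and> \<bar>\<omega>\<bar> \<le> pi / dt quad Ch h \<and> km \<le> \<bar>k\<bar> \<and> \<bar>k\<bar> \<le> pi / h}"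

definition robin_sup :: "real \<Rightarrow> real \<Rightarrow> real \<Rightarrow> real \<Rightarrow> bool \<Rightarrow> real \<Rightarrow> real \<Rightarrow> real \<Rightarrow> real \<Rightarrow> complex \<Rightarrow> ereal" where
  "robin_sup \<nu> a b c quad Ch km \<omega>m h p =
     (SUP z \<in> freq_dom quad Ch km \<omega>m h. ereal (cmod (rho \<nu> a b c (fst z) (snd z) p 0 0)))"

definition kbar :: "real \<Rightarrow> real \<Rightarrow> real \<Rightarrow> real \<Rightarrow> real \<Rightarrow> real" where
  "kbar \<nu> a b c \<omega>m =
     \<bar>c\<bar> * (sqrt ((c\<^sup>2 + x0sq \<nu> a b)\<^sup>2 + 16 * \<nu>\<^sup>2 * \<omega>m\<^sup>2) - (c\<^sup>2 + x0sq \<nu> a b))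
       / (8 * \<nu>\<^sup>2 * \<omega>m)"

definition phi :: "real \<Rightarrow> real \<Rightarrow> real \<Rightarrow> real \<Rightarrow> real \<Rightarrow> real" where
  "phi \<nu> a b k \<xi> =
     2 * sqrt 2 * sqrt (sqrt ((x0sq \<nu> a b + 4 * \<nu>\<^sup>2 * k\<^sup>2)\<^sup>2 + 16 * \<nu>\<^sup>2 * \<xi>\<^sup>2)
                          + x0sq \<nu> a b + 4 * \<nu>\<^sup>2 * k\<^sup>2)"

text \<open>The constant A. The condition k_m <= omega_m/|c| is written |c| k_m <= omega_m
  (so that for c = 0 it always holds, as omega_m/|c| = +infinity).\<close>
definition constA :: "real \<Rightarrow> real \<Rightarrow> real \<Rightarrow> real \<Rightarrow> real \<Rightarrow> real \<Rightarrow> real" where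
  "constA \<nu> a b c km \<omega>m =
     (let kb = kbar \<nu> a b c \<omega>m in
      if km \<le> kb then phi \<nu> a b kb (- \<omega>m + \<bar>c\<bar> * kb)
      else if \<bar>c\<bar> * km \<le> \<omega>m then phi \<nu> a b km (- \<omega>m + \<bar>c\<bar> * km)
      else phi \<nu> a b km 0)"

definition d0 :: real where
  "d0 = (THE d. d ^ 3 - 2 * d\<^sup>2 + 2 * d - 2 = 0)"

definition constB :: "real \<Rightarrow> bool \<Rightarrow> real \<Rightarrow> real" where
  "constB \<nu> quad Ch =
     (if \<not> quad then 2 / (\<nu> * pi)
      else (let d = \<nu> * pi * Ch;
                C = (if d < d0 then 1 else sqrt ((d + sqrt (1 + d\<^sup>2)) / (1 + d\<^sup>2)))
            in C * sqrt (2 * d) / (\<nu> * pi)))"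

end

theory Submission
  imports Defs "HOL-Analysis.Analysis" "HOL-Real_Asymp.Real_Asymp"
begin

text \<open>
  Write \<open>z\<close> for the square root in the convergence factor, so that the Robin factor is
  \<open>(p - z) / (p + z)\<close>. For \<open>\<delta> < 1\<close> the condition \<open>cmod (p - z) \<le> \<delta> * cmod (p + z)\<close> describes a
  disc in \<open>p\<close>; strict convexity of discs and compactness of the set of all \<open>z\<close> give existence and
  uniqueness of the best \<open>p\<close>, and invariance of that set under conjugation makes it real.

  For real \<open>p\<close>, minimizing the factor means minimizing the maximum of
  \<open>F = (p / Re z + ((cmod z)\<^sup>2 / Re z) / p) / 2\<close>. The minimum of \<open>Re z\<close> over the frequency domain is
  \<open>A / 4\<close> and the maximum of \<open>(cmod z)\<^sup>2 / Re z\<close> is asymptotically \<open>4 / (B * h)\<close>. The first quantity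
  is attained at bounded \<open>z\<close>, the second at large \<open>Re z\<close>, so the two terms of \<open>F\<close> do not interact and
  are balanced by \<open>p = sqrt (A / (B * h))\<close>.
\<close>

section \<open>Best Robin parameters for compact sets\<close>

text \<open>The optimal \<open>p\<close> is never computed and no equioscillation is established.
  One trial \<open>p\<close> bounds the optimal value from above, while two single points of the set
  bound \<open>p\<close> and the value from the other side; these inequalities meet in leading
  order. Decoupling rests on the radicand having nonnegative real part: then
  \<open>(cmod z)\<^sup>2 / Re z\<close> is at most \<open>2 * Re z\<close>, so no point makes both
  terms of \<open>F\<close> large at once. In the plane of the radicand with parts \<open>X\<close>
  and \<open>Y\<close> the curves of constant \<open>Re z\<close> are parabolas, so minimizing
  \<open>Re z\<close> along an edge \<open>\<bar>\<omega>\<bar> = \<omega>m\<close> is a tangency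
  problem for a quadratic in \<open>k\<close>; this is the origin of \<open>kbar\<close>. For
  \<open>constB\<close>, scaling the radicand by \<open>h\<^sup>2\<close> leaves a bounded limit
  region, on which \<open>(cmod z)\<^sup>2 / Re z\<close> is largest at one of the two ends of the
  side of largest \<open>Y\<close>: at \<open>X = 0\<close> or at the corner. For quadratic time
  steps \<open>d\<close> is the ratio \<open>X / Y\<close> at that corner, and \<open>d0\<close> is
  the value at which both ends tie.\<close>

definition robin_dev :: "complex set \<Rightarrow> complex \<Rightarrow> ereal" where
  "robin_dev K p = (SUP z\<in>K. ereal (cmod ((p - z) / (p + z))))"

text \<open>The last two clauses state optimality in product form, where no division can hide a
  pole. The asymptotic argument uses only these and the ranges of \<open>P\<close> and
  \<open>\<delta>\<close>; the last clause turns any trial parameter into an upper bound for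
  \<open>\<delta>\<close>.\<close>

definition robin_optimum :: "complex set \<Rightarrow> real \<Rightarrow> real \<Rightarrow> bool" where
  "robin_optimum K P \<delta> \<longleftrightarrow> P > 0 \<and> 0 \<le> \<delta> \<and> \<delta> < 1
    \<and> (\<forall>p. robin_dev K p = (INF p'. robin_dev K p') \<longleftrightarrow> p = complex_of_real P)
    \<and> (INF p. robin_dev K p) = ereal \<delta>
    \<and> (\<forall>z\<in>K. cmod (of_real P - z) \<le> \<delta> * cmod (of_real P + z))
    \<and> (\<forall>p e. 0 \<le> e \<longrightarrow> (\<forall>z\<in>K. cmod (p - z) \<le> e * cmod (p + z)) \<longrightarrow> \<delta> \<le> e)"

lemma cmod_diff_sum_power2:
  fixes p z :: complex
  shows "(cmod (p - z))\<^sup>2 - (e * cmod (p + z))\<^sup>2 =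
    (1 - e\<^sup>2) * ((cmod p)\<^sup>2 + (cmod z)\<^sup>2) - 2 * (1 + e\<^sup>2) * Re (p * cnj z)"
  unfolding power_mult_distrib cmod_power2 by (simp add: power2_eq_square algebra_simps)

lemma cmod_diff_le_iff:
  fixes p z :: complex
  assumes "0 \<le> e"
  shows "cmod (p - z) \<le> e * cmod (p + z) \<longleftrightarrow>
    (1 - e\<^sup>2) * ((cmod p)\<^sup>2 + (cmod z)\<^sup>2) \<le> 2 * (1 + e\<^sup>2) * Re (p * cnj z)"
proof -
  have "cmod (p - z) \<le> e * cmod (p + z) \<longleftrightarrow> (cmod (p - z))\<^sup>2 \<le> (e * cmod (p + z))\<^sup>2"
    using assms by (intro abs_le_square_iff[THEN trans[rotated]]) auto
  also have "\<dots> \<longleftrightarrow> (cmod (p - z))\<^sup>2 - (e * cmod (p + z))\<^sup>2 \<le> 0" by linarith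
  also have "\<dots> \<longleftrightarrow> (1 - e\<^sup>2) * ((cmod p)\<^sup>2 + (cmod z)\<^sup>2) - 2 * (1 + e\<^sup>2) * Re (p * cnj z) \<le> 0"
    by (simp only: cmod_diff_sum_power2)
  finally show ?thesis by linarith
qed

text \<open>For fixed \<open>z\<close> and \<open>e < 1\<close> the set of \<open>p\<close> with \<open>cmod (p - z) \<le> e * cmod (p + z)\<close> is a disc,
  hence strictly convex.\<close>

lemma cmod_diff_midpoint_less:
  fixes p q z :: complex
  assumes "0 \<le> e" "e < 1" "p \<noteq> q"
    and "cmod (p - z) \<le> e * cmod (p + z)" "cmod (q - z) \<le> e * cmod (q + z)"
  shows "cmod ((p + q) / 2 - z) < e * cmod ((p + q) / 2 + z)"
proof -
  define m where "m = (p + q) / 2"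
  define \<Phi> where "\<Phi> p = (1 - e\<^sup>2) * ((cmod p)\<^sup>2 + (cmod z)\<^sup>2) - 2 * (1 + e\<^sup>2) * Re (p * cnj z)" for p
  have le: "\<Phi> p \<le> 0" "\<Phi> q \<le> 0"
    using assms unfolding \<Phi>_def by (simp_all add: cmod_diff_le_iff del: complex_Re_numeral)
  have m: "Re m = (Re p + Re q) / 2" "Im m = (Im p + Im q) / 2" by (simp_all add: m_def)
  \<comment> \<open>Parallelogram law; the term \<open>(cmod (p - q))\<^sup>2 / 4\<close> is the
    source of strictness.\<close>
  have "(cmod m)\<^sup>2 = ((cmod p)\<^sup>2 + (cmod q)\<^sup>2) / 2 - (cmod (p - q))\<^sup>2 / 4"
    unfolding cmod_power2 m by (simp add: field_simps power2_eq_square)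
  moreover have "Re (m * cnj z) = (Re (p * cnj z) + Re (q * cnj z)) / 2"
    by (simp add: m field_simps)
  ultimately have "\<Phi> m = (\<Phi> p + \<Phi> q) / 2 - (1 - e\<^sup>2) * (cmod (p - q))\<^sup>2 / 4"
    unfolding \<Phi>_def by (simp only:) (simp add: field_simps)
  moreover have "(1 - e\<^sup>2) * (cmod (p - q))\<^sup>2 > 0"
    using assms by (simp add: abs_square_less_1)
  moreover have "s < 0" if "s = (u + v) / 2 - t / 4" "t > 0" "u \<le> 0" "v \<le> 0" for s t u v :: real
    using that by argo
  ultimately have "\<Phi> m < 0" using le by blast
  moreover have "(cmod (m - z))\<^sup>2 - (e * cmod (m + z))\<^sup>2 = \<Phi> m"
    unfolding \<Phi>_def by (rule cmod_diff_sum_power2)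
  ultimately have "(cmod (m - z))\<^sup>2 < (e * cmod (m + z))\<^sup>2" by linarith
  then have "cmod (m - z) < e * cmod (m + z)"
    by (rule power2_less_imp_less) (use assms in auto)
  then show ?thesis by (simp add: m_def)
qed

text \<open>Since \<open>x / 0 = 0\<close>, the factor vanishes at a pole \<open>z = - p\<close>. This does not create spurious
  minimizers: within the sector \<open>\<bar>Im z\<bar> \<le> Re z\<close> it is at least 1 at any other point of \<open>K\<close>.\<close>

lemma robin_dev_le_iff:
  assumes e: "0 \<le> e" "e < 1" and sec: "\<And>z. z \<in> K \<Longrightarrow> Re z > 0 \<and> \<bar>Im z\<bar> \<le> Re z"
    and "z1 \<in> K" "z2 \<in> K" "z1 \<noteq> z2"
  shows "robin_dev K p \<le> ereal e \<longleftrightarrow> (\<forall>z\<in>K. cmod (p - z) \<le> e * cmod (p + z))"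
proof
  assume *: "\<forall>z\<in>K. cmod (p - z) \<le> e * cmod (p + z)"
  have "cmod ((p - z) / (p + z)) \<le> e" if "z \<in> K" for z
    using *[rule_format, OF that] e
    by (cases "p + z = 0") (auto simp: norm_divide field_simps)
  then show "robin_dev K p \<le> ereal e"
    unfolding robin_dev_def by (auto intro!: SUP_least)
next
  assume le: "robin_dev K p \<le> ereal e"
  have q: "cmod ((p - z) / (p + z)) \<le> e" if "z \<in> K" for z
    using le that unfolding robin_dev_def by (metis SUP_le_iff ereal_less_eq(3))
  show "\<forall>z\<in>K. cmod (p - z) \<le> e * cmod (p + z)"
  proof
    fix z assume z: "z \<in> K"
    have "p + z \<noteq> 0"
    proof
      assume 0: "p + z = 0"
      then have p: "p = - z" by (simp add: add_eq_0_iff2)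
      obtain w where w: "w \<in> K" "w \<noteq> z" using assms(4-6) by metis
      have pw: "cmod (p + w) > 0" using p w by simp
      then have le: "cmod (p - w) \<le> e * cmod (p + w)"
        using q[OF w(1)] by (simp add: norm_divide field_simps)
      \<comment> \<open>Two points of the sector enclose at most a right angle, so
        \<open>Re (z * cnj w) \<ge> 0\<close>; with \<open>p = - z\<close> the factor at
        \<open>w\<close> then has modulus at least 1.\<close>
      have "\<bar>Im z * Im w\<bar> \<le> Re z * Re w"
        unfolding abs_mult using sec[OF z] sec[OF w(1)] by (intro mult_mono) auto
      then have "(cmod (p + w))\<^sup>2 \<le> (cmod (p - w))\<^sup>2"
        unfolding cmod_power2 p by (simp add: power2_eq_square algebra_simps)
      then have "cmod (p + w) \<le> cmod (p - w)" by (rule power2_le_imp_le) simp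
      also note le
      also have "e * cmod (p + w) < 1 * cmod (p + w)"
        using e pw by (intro mult_strict_right_mono) auto
      finally show False by simp
    qed
    then show "cmod (p - z) \<le> e * cmod (p + z)"
      using q[OF z] by (simp add: norm_divide field_simps)
  qed
qed

text \<open>Compactness makes a pointwise strict bound uniform: the quotient attains its maximum,
  which is below \<open>e\<close>. This shows that the trial value \<open>p = 1\<close> has
  deviation below 1, and that the midpoint of two optimal parameters would beat the optimum.\<close>

lemma compact_strict_contraction:
  fixes q :: complex
  assumes "compact K" "K \<noteq> {}" and less: "\<And>z. z \<in> K \<Longrightarrow> cmod (q - z) < e * cmod (q + z)"
  obtains e' where "0 \<le> e'" "e' < e" "\<And>z. z \<in> K \<Longrightarrow> cmod (q - z) \<le> e' * cmod (q + z)"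
proof -
  have nz: "cmod (q + z) > 0" if "z \<in> K" for z
    using less[OF that] by (cases "q + z = 0") auto
  have "continuous_on K (\<lambda>z. cmod (q - z) / cmod (q + z))"
    using nz by (intro continuous_intros) (metis less_irrefl)
  then obtain z0 where z0: "z0 \<in> K"
      "\<And>z. z \<in> K \<Longrightarrow> cmod (q - z) / cmod (q + z) \<le> cmod (q - z0) / cmod (q + z0)"
    using continuous_attains_sup[OF assms(1,2)] by blast
  show ?thesis
  proof
    show "0 \<le> cmod (q - z0) / cmod (q + z0)" by simp
    show "cmod (q - z0) / cmod (q + z0) < e"
      using less[OF z0(1)] nz[OF z0(1)] by (simp add: field_simps)
    show "cmod (q - z) \<le> cmod (q - z0) / cmod (q + z0) * cmod (q + z)" if "z \<in> K" for z
      using z0(2)[OF that] nz[OF that] by (simp add: pos_divide_le_eq)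
  qed
qed

text \<open>The limit of near-minimizers is taken in product form, pointwise in \<open>z\<close>, so
  that no continuity of the quotient near poles is required. Two distinct points rule out a
  parameter sitting on a pole; the optimum is real because its conjugate is optimal too.\<close>

lemma ex_robin_optimum:
  assumes K: "compact K" and sec: "\<And>z. z \<in> K \<Longrightarrow> Re z > 0 \<and> \<bar>Im z\<bar> \<le> Re z"
    and two: "z1 \<in> K" "z2 \<in> K" "z1 \<noteq> z2" and cnj: "\<And>z. z \<in> K \<Longrightarrow> cnj z \<in> K"
  shows "\<exists>P \<delta>. robin_optimum K P \<delta>"
proof -
  note iff = robin_dev_le_iff[OF _ _ sec two]
  define I where "I = (INF p. robin_dev K p)"
  define L where "L e = {p. \<forall>z\<in>K. cmod (p - z) \<le> e * cmod (p + z)}" for e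
  have nonneg: "0 \<le> robin_dev K p" for p
    unfolding robin_dev_def using two(1) by (intro SUP_upper2[of z1]) auto
  have I0: "0 \<le> I" unfolding I_def by (intro INF_greatest nonneg)
  have ne: "K \<noteq> {}" using two(1) by blast
  have less1: "cmod (1 - z) < 1 * cmod (1 + z)" if "z \<in> K" for z
  proof -
    have "(cmod (1 - z))\<^sup>2 < (cmod (1 + z))\<^sup>2"
      unfolding cmod_power2 using sec[OF that] by (simp add: power2_eq_square algebra_simps)
    then show ?thesis by (simp add: power2_less_imp_less)
  qed
  obtain e1 where e1: "0 \<le> e1" "e1 < 1" "\<And>z. z \<in> K \<Longrightarrow> cmod (1 - z) \<le> e1 * cmod (1 + z)"
    by (rule compact_strict_contraction[OF K ne]) (blast intro: less1)+
  have "robin_dev K 1 \<le> ereal e1" using iff[OF e1(1,2)] e1(3) by simp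
  then have "I \<le> ereal e1" unfolding I_def by (rule INF_lower2[OF UNIV_I])
  then obtain \<delta> where \<delta>: "I = ereal \<delta>" "0 \<le> \<delta>" "\<delta> \<le> e1"
    using I0 by (cases I) auto
  have \<delta>1: "\<delta> < 1" using \<delta> e1 by linarith
  have minimal: "\<delta> \<le> e" if "0 \<le> e" "\<And>z. z \<in> K \<Longrightarrow> cmod (p - z) \<le> e * cmod (p + z)" for p e
  proof (cases "e < 1")
    case True
    then have "robin_dev K p \<le> ereal e" using iff[OF that(1)] that(2) by simp
    then have "I \<le> ereal e" unfolding I_def by (rule INF_lower2[OF UNIV_I])
    then show ?thesis using \<delta> by simp
  qed (use \<delta>1 in simp)
  \<comment> \<open>Levels decreasing to \<open>\<delta>\<close>; the offset 2 keeps them all at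
    most \<open>(1 + \<delta>) / 2\<close>, a common bound below 1 that confines the chosen
    parameters to a bounded set.\<close>
  define e where "e n = \<delta> + (1 - \<delta>) / (real n + 2)" for n
  have e_le: "e n \<le> (1 + \<delta>) / 2" for n
  proof -
    have "(1 - \<delta>) / (real n + 2) \<le> (1 - \<delta>) / 2"
      using \<delta>1 by (intro divide_left_mono) auto
    then show ?thesis unfolding e_def by (simp add: field_simps)
  qed
  have e: "\<delta> < e n" "e n < 1" "0 \<le> e n" for n
  proof -
    show "\<delta> < e n" using \<delta>1 by (simp add: e_def)
    then show "0 \<le> e n" using \<delta>(2) by linarith
    show "e n < 1" using \<delta>1 e_le[of n] by argo
  qed
  have "\<exists>p. p \<in> L (e n)" for n
  proof -
    have "I < ereal (e n)" using \<delta> e by simp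
    then obtain p where "robin_dev K p < ereal (e n)" unfolding I_def by (auto simp: INF_less_iff)
    then have "robin_dev K p \<le> ereal (e n)" by (rule less_imp_le)
    then have "p \<in> L (e n)" using iff[OF e(3,2), of p n] by (simp add: L_def)
    then show ?thesis ..
  qed
  then obtain p where p: "\<And>n. p n \<in> L (e n)" by metis
  have "cmod (p n) \<le> (1 + (1 + \<delta>) / 2) * cmod z1 / (1 - (1 + \<delta>) / 2)" for n
  proof -
    have "cmod (p n) - cmod z1 \<le> cmod (p n - z1)" by (rule norm_triangle_ineq2)
    also have "\<dots> \<le> e n * cmod (p n + z1)" using p[of n] two(1) by (simp add: L_def)
    also have "\<dots> \<le> (1 + \<delta>) / 2 * (cmod (p n) + cmod z1)"
      using e_le[of n] \<delta>(2) by (intro mult_mono norm_triangle_ineq) auto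
    finally show ?thesis using \<delta>1 by (simp add: field_simps)
  qed
  then have "bounded (range p)" by (auto simp: bounded_iff)
  then obtain P r where r: "strict_mono r" "(p \<circ> r) \<longlonglongrightarrow> P"
    using bounded_imp_convergent_subsequence by blast
  have "e \<longlonglongrightarrow> \<delta>"
    unfolding e_def by real_asymp
  then have er: "(\<lambda>n. e (r n)) \<longlonglongrightarrow> \<delta>"
    using LIMSEQ_subseq_LIMSEQ[OF _ r(1), of e \<delta>] by (simp add: o_def)
  have PL: "P \<in> L \<delta>"
    unfolding L_def
  proof safe
    fix z assume "z \<in> K"
    have pr: "(\<lambda>n. p (r n)) \<longlonglongrightarrow> P" using r(2) by (simp add: o_def)
    show "cmod (P - z) \<le> \<delta> * cmod (P + z)"
    proof (rule LIMSEQ_le)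
      show "(\<lambda>n. cmod (p (r n) - z)) \<longlonglongrightarrow> cmod (P - z)" by (intro tendsto_intros pr)
      show "(\<lambda>n. e (r n) * cmod (p (r n) + z)) \<longlonglongrightarrow> \<delta> * cmod (P + z)"
        by (intro tendsto_intros pr er)
      show "\<exists>N. \<forall>n\<ge>N. cmod (p (r n) - z) \<le> e (r n) * cmod (p (r n) + z)"
        using p \<open>z \<in> K\<close> by (auto simp: L_def)
    qed
  qed
  have sol: "robin_dev K p = I \<longleftrightarrow> p \<in> L \<delta>" for p
  proof -
    have "I \<le> robin_dev K p" unfolding I_def by (rule INF_lower) simp
    then have "robin_dev K p = I \<longleftrightarrow> robin_dev K p \<le> ereal \<delta>" using \<delta> by auto
    then show ?thesis using iff[OF \<delta>(2) \<delta>1] by (simp add: L_def)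
  qed
  have uniq: "p = q" if "p \<in> L \<delta>" "q \<in> L \<delta>" for p q
  proof (rule ccontr)
    assume "p \<noteq> q"
    then have less: "cmod ((p + q) / 2 - z) < \<delta> * cmod ((p + q) / 2 + z)" if "z \<in> K" for z
      using cmod_diff_midpoint_less[OF \<delta>(2) \<delta>1] \<open>p \<in> L \<delta>\<close> \<open>q \<in> L \<delta>\<close> that by (simp add: L_def)
    obtain e' where "0 \<le> e'" "e' < \<delta>"
        "\<And>z. z \<in> K \<Longrightarrow> cmod ((p + q) / 2 - z) \<le> e' * cmod ((p + q) / 2 + z)"
      by (rule compact_strict_contraction[OF K ne]) (blast intro: less)+
    then show False using minimal[of e' "(p + q) / 2"] by simp
  qed
  have "cnj P \<in> L \<delta>"
    unfolding L_def
  proof safe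
    fix z assume "z \<in> K"
    then have "cmod (P - cnj z) \<le> \<delta> * cmod (P + cnj z)" using PL cnj by (simp add: L_def)
    moreover have "cnj (cnj P - z) = P - cnj z" "cnj (cnj P + z) = P + cnj z" by simp_all
    ultimately show "cmod (cnj P - z) \<le> \<delta> * cmod (cnj P + z)" by (metis complex_mod_cnj)
  qed
  then have "cnj P = P" using uniq PL by blast
  then have P: "P = of_real (Re P)" by (metis Reals_cnj_iff of_real_Re)
  \<comment> \<open>The left side of the disc inequality is positive, so \<open>P\<close> and
    \<open>z1\<close> have positive inner product; as \<open>P\<close> is real, it has the sign of
    \<open>Re z1\<close>.\<close>
  have "(1 - \<delta>\<^sup>2) * ((cmod P)\<^sup>2 + (cmod z1)\<^sup>2) \<le> 2 * (1 + \<delta>\<^sup>2) * Re (P * cnj z1)"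
    unfolding cmod_diff_le_iff[OF \<delta>(2), symmetric] using PL two(1) by (simp add: L_def)
  moreover have "(1 - \<delta>\<^sup>2) * ((cmod P)\<^sup>2 + (cmod z1)\<^sup>2) > 0"
    using sec[OF two(1)] \<delta>(2) \<delta>1 by (intro mult_pos_pos add_nonneg_pos) (auto simp: abs_square_less_1)
  ultimately have "0 < (2 * (1 + \<delta>\<^sup>2)) * Re (P * cnj z1)" by linarith
  moreover have "2 * (1 + \<delta>\<^sup>2) > 0" by (simp add: add_pos_nonneg)
  ultimately have "Re (P * cnj z1) > 0" by (rule zero_less_mult_pos)
  then have "Re P * Re z1 > 0" by (subst (asm) P) simp
  then have pos: "Re P > 0" using sec[OF two(1)] by (simp add: zero_less_mult_iff)
  have "robin_dev K p = I \<longleftrightarrow> p = complex_of_real (Re P)" for p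
    using sol uniq PL P by metis
  then have "robin_optimum K (Re P) \<delta>"
    unfolding robin_optimum_def I_def[symmetric]
    using pos \<delta>(1,2) \<delta>1 PL[unfolded L_def] P by (simp, blast intro: minimal)
  then show ?thesis by blast
qed

section \<open>Asymptotic balancing\<close>

text \<open>The increasing map from \<open>e\<close> to
  \<open>(1 + e\<^sup>2) / (1 - e\<^sup>2)\<close> turns a bound on the factor into a bound on the
  two-term sum \<open>F\<close>. It blows up as \<open>e\<close> tends to 1, so its growth rate
  encodes the size of \<open>1 - e\<close>.\<close>

lemma cmod_real_diff_le_iff:
  fixes P e :: real
  assumes "0 \<le> e" "e < 1"
  shows "cmod (of_real P - z) \<le> e * cmod (of_real P + z) \<longleftrightarrow>
    P\<^sup>2 + (cmod z)\<^sup>2 \<le> 2 * ((1 + e\<^sup>2) / (1 - e\<^sup>2)) * (P * Re z)"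
proof -
  have "1 - e\<^sup>2 > 0" using assms by (simp add: abs_square_less_1)
  then show ?thesis
    unfolding cmod_diff_le_iff[OF assms(1)] by (simp add: field_simps)
qed

text \<open>With \<open>F = (p\<^sup>2 + (cmod z)\<^sup>2) / (2 * p * Re z)\<close> the squared factor at real \<open>p\<close> is
  \<open>(F - 1) / (F + 1)\<close>. As \<open>h\<close> tends to 0, the maximum of \<open>F\<close> is governed by \<open>p / m\<close>
  (points with smallest real part) and by \<open>M / (h * p)\<close> (points with large \<open>(cmod z)\<^sup>2 / Re z\<close>);
  balancing both gives \<open>p = sqrt (m * M / h)\<close>. The two regimes are separated at \<open>Re z = 1 / sqrt h\<close>.\<close>

lemma robin_deviation_upper:
  fixes h m M bu \<delta> :: real
  assumes pos: "h > 0" "m > 0" "M > 0" and \<delta>: "0 \<le> \<delta>" "\<delta> < 1" and "K \<noteq> {}"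
    and K: "\<And>z. z \<in> K \<Longrightarrow> m \<le> Re z \<and> (cmod z)\<^sup>2 \<le> 2 * (Re z)\<^sup>2 \<and> h * (cmod z)\<^sup>2 \<le> bu * Re z"
    and min: "\<And>p e. 0 \<le> e \<Longrightarrow> (\<And>z. z \<in> K \<Longrightarrow> cmod (p - z) \<le> e * cmod (p + z)) \<Longrightarrow> \<delta> \<le> e"
  shows "2 * ((1 + \<delta>\<^sup>2) / (1 - \<delta>\<^sup>2)) * sqrt h \<le>
    max (sqrt (M / m) + 2 * sqrt h / sqrt (m * M)) (sqrt (m * M) * sqrt h + bu / sqrt (m * M))"
    (is "_ \<le> ?U")
proof -
  define s where "s = sqrt h"
  define q where "q = sqrt (m * M)"
  define U where "U = ?U"
  have s: "s > 0" "s\<^sup>2 = h" and q: "q > 0" "q\<^sup>2 = m * M" using pos by (simp_all add: s_def q_def)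
  have Mm: "sqrt (M / m) * q = M"
    using pos by (simp add: q_def flip: real_sqrt_mult) 
  have U1: "sqrt (M / m) + 2 * s / q \<le> U" and U2: "q * s + bu / q \<le> U"
    unfolding U_def s_def q_def by simp_all
  define p where "p = q / s"
  define F where "F = U / (2 * s)"
  have p: "p > 0" using s q by (simp add: p_def)
  have key: "p\<^sup>2 + (cmod z)\<^sup>2 \<le> 2 * F * (p * Re z)" if z: "z \<in> K" for z
  proof -
    have x: "m \<le> Re z" "0 < Re z" using K[OF z] pos by auto
    have "q\<^sup>2 + s\<^sup>2 * (cmod z)\<^sup>2 \<le> U * q * Re z"
    \<comment> \<open>In the first regime the sector bound makes \<open>(cmod z)\<^sup>2\<close>
      cost only the correction \<open>2 * s / q\<close>; in the second,
      \<open>1 \<le> Re z * s\<close> makes \<open>q\<^sup>2\<close> cost only \<open>q * s\<close>.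
      Both corrections vanish with \<open>s\<close>.\<close>
    proof (cases "Re z * s \<le> 1")
      case True
      have "s\<^sup>2 * (cmod z)\<^sup>2 \<le> s\<^sup>2 * (2 * (Re z)\<^sup>2)"
        using K[OF z] by (intro mult_left_mono) auto
      also have "\<dots> = 2 * (s * Re z) * (Re z * s)" by (simp add: power2_eq_square)
      also have "\<dots> \<le> 2 * (s * Re z) * 1" using True s x by (intro mult_left_mono) auto
      finally have "s\<^sup>2 * (cmod z)\<^sup>2 \<le> 2 * s * Re z" by simp
      moreover have "q\<^sup>2 \<le> M * Re z" using q x pos by (simp add: mult.commute)
      moreover have "(M + 2 * s) * Re z \<le> U * q * Re z"
      proof (rule mult_right_mono)
        have "M + 2 * s = (sqrt (M / m) + 2 * s / q) * q" using q Mm by (simp add: field_simps)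
        also have "\<dots> \<le> U * q" using U1 q by (intro mult_right_mono) auto
        finally show "M + 2 * s \<le> U * q" .
      qed (use x in simp)
      ultimately show ?thesis by (simp add: algebra_simps)
    next
      case False
      have "q\<^sup>2 * 1 \<le> q\<^sup>2 * (Re z * s)" using False by (intro mult_left_mono) auto
      moreover have "s\<^sup>2 * (cmod z)\<^sup>2 \<le> bu * Re z" using K[OF z] s by simp
      moreover have "(q\<^sup>2 * s + bu) * Re z \<le> U * q * Re z"
      proof (rule mult_right_mono)
        have "q\<^sup>2 * s + bu = (q * s + bu / q) * q" using q(1) by (simp add: field_simps power2_eq_square)
        also have "\<dots> \<le> U * q" using U2 q by (intro mult_right_mono) auto
        finally show "q\<^sup>2 * s + bu \<le> U * q" .
      qed (use x in simp)
      ultimately show ?thesis by (simp add: algebra_simps)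
    qed
    then have "(q\<^sup>2 + s\<^sup>2 * (cmod z)\<^sup>2) / s\<^sup>2 \<le> U * q * Re z / s\<^sup>2"
      using s by (intro divide_right_mono) auto
    moreover have "p\<^sup>2 + (cmod z)\<^sup>2 = (q\<^sup>2 + s\<^sup>2 * (cmod z)\<^sup>2) / s\<^sup>2"
      using s(1) by (simp add: p_def field_simps)
    moreover have "2 * F * (p * Re z) = U * q * Re z / s\<^sup>2"
      using s(1) by (simp add: p_def F_def power2_eq_square)
    ultimately show ?thesis by simp
  qed
  obtain z where z: "z \<in> K" using \<open>K \<noteq> {}\<close> by blast
  have x: "0 < Re z" using K[OF z] pos by auto
  \<comment> \<open>The inequality of arithmetic and geometric means at a single point forces
    \<open>F \<ge> 1\<close>, which makes the level \<open>e\<close> chosen next real.\<close>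
  have F1: "F \<ge> 1"
  proof -
    have "2 * (p * Re z) \<le> p\<^sup>2 + (Re z)\<^sup>2" using zero_le_power2[of "p - Re z"] by (simp add: power2_eq_square algebra_simps)
    also have "\<dots> \<le> p\<^sup>2 + (cmod z)\<^sup>2" by (simp add: cmod_power2)
    also note key[OF z]
    finally have "1 * (p * Re z) \<le> F * (p * Re z)" by simp
    then show ?thesis using p x by (simp add: mult_le_cancel_right_pos)
  qed
  \<comment> \<open>The solution of \<open>(1 + e\<^sup>2) / (1 - e\<^sup>2) = F\<close>.\<close>
  define e where "e = sqrt ((F - 1) / (F + 1))"
  have e2: "e\<^sup>2 = (F - 1) / (F + 1)" using F1 by (simp add: e_def)
  have e: "0 \<le> e" "e < 1" using F1 by (simp_all add: e_def)
  have Fe: "(1 + e\<^sup>2) / (1 - e\<^sup>2) = F" unfolding e2 using F1 by (simp add: field_simps)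
  have "\<delta> \<le> e"
    by (rule min[of e "of_real p"]) (use e key in \<open>simp_all add: cmod_real_diff_le_iff Fe del: of_real_divide\<close>)
  then have "\<delta>\<^sup>2 \<le> e\<^sup>2" using \<delta> by (simp add: power_mono)
  moreover have "e\<^sup>2 < 1" using e by (simp add: abs_square_less_1)
  ultimately have "(1 + \<delta>\<^sup>2) / (1 - \<delta>\<^sup>2) \<le> (1 + e\<^sup>2) / (1 - e\<^sup>2)"
    by (intro frac_le) auto
  then have "2 * ((1 + \<delta>\<^sup>2) / (1 - \<delta>\<^sup>2)) * s \<le> 2 * F * s"
    unfolding Fe using s by (intro mult_right_mono mult_left_mono) auto
  also have "\<dots> = U" using s by (simp add: F_def)
  finally show ?thesis by (simp add: U_def s_def)
qed

text \<open>At the point with \<open>Re z = m\<close> discarding \<open>(cmod z)\<^sup>2\<close>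
  gives \<open>P \<le> 2 * F * m\<close>; at the point of nearly maximal ratio discarding
  \<open>P\<^sup>2\<close> gives \<open>bl \<le> 2 * h * F * P\<close>. Combined with
  \<open>2 * F * sqrt h \<le> U\<close> these squeeze \<open>P * sqrt h\<close> between
  \<open>bl / U\<close> and \<open>m * U\<close>, whose limits agree.\<close>

lemma robin_asymptotics:
  fixes P \<delta> bu bl :: "real \<Rightarrow> real" and m M :: real and K :: "real \<Rightarrow> complex set"
  assumes pos: "m > 0" "M > 0" and lim: "(bu \<longlongrightarrow> M) (at_right 0)" "(bl \<longlongrightarrow> M) (at_right 0)"
    and opt: "\<forall>\<^sub>F h in at_right 0. robin_optimum (K h) (P h) (\<delta> h)"
    and K: "\<forall>\<^sub>F h in at_right 0. \<forall>z\<in>K h. m \<le> Re z \<and> (cmod z)\<^sup>2 \<le> 2 * (Re z)\<^sup>2 \<and> h * (cmod z)\<^sup>2 \<le> bu h * Re z"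
    and zm: "\<forall>\<^sub>F h in at_right 0. \<exists>z\<in>K h. Re z = m"
    and zM: "\<forall>\<^sub>F h in at_right 0. \<exists>z\<in>K h. bl h * Re z \<le> h * (cmod z)\<^sup>2"
  shows "((\<lambda>h. P h * sqrt h) \<longlongrightarrow> sqrt (m * M)) (at_right 0)"
    and "((\<lambda>h. (1 - \<delta> h) / sqrt h) \<longlongrightarrow> 2 * sqrt (m / M)) (at_right 0)"
proof -
  have P: "\<forall>\<^sub>F h in at_right 0. P h > 0"
    and \<delta>: "\<forall>\<^sub>F h in at_right 0. 0 \<le> \<delta> h \<and> \<delta> h < 1"
    and sol: "\<forall>\<^sub>F h in at_right 0. \<forall>z\<in>K h. cmod (of_real (P h) - z) \<le> \<delta> h * cmod (of_real (P h) + z)"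
    and min: "\<forall>\<^sub>F h in at_right 0. \<forall>p e. 0 \<le> e \<longrightarrow> (\<forall>z\<in>K h. cmod (p - z) \<le> e * cmod (p + z)) \<longrightarrow> \<delta> h \<le> e"
    using opt unfolding robin_optimum_def by (auto simp: eventually_conj_iff)
  define U where "U h = max (sqrt (M / m) + 2 * sqrt h / sqrt (m * M))
    (sqrt (m * M) * sqrt h + bu h / sqrt (m * M))" for h
  define F where "F h = (1 + (\<delta> h)\<^sup>2) / (1 - (\<delta> h)\<^sup>2)" for h
  have h0: "\<forall>\<^sub>F h in at_right 0. (h::real) > 0" by (rule eventually_at_right_less)
  have sqrt0: "((\<lambda>h. sqrt h) \<longlongrightarrow> sqrt 0) (at_right 0)" by (intro tendsto_intros)
  have eqs: "M / sqrt (m * M) = sqrt (M / m)" "M / sqrt (M / m) = sqrt (m * M)" "m * sqrt (M / m) = sqrt (m * M)"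
    "sqrt (m * M) / (2 * m) = sqrt (M / m) / 2" "1 / (sqrt (M / m) / 2) = 2 * sqrt (m / M)"
    using pos by (simp_all add: real_sqrt_mult real_sqrt_divide field_simps)
  have "(U \<longlongrightarrow> max (sqrt (M / m) + 2 * sqrt 0 / sqrt (m * M)) (sqrt (m * M) * sqrt 0 + M / sqrt (m * M))) (at_right 0)"
    unfolding U_def by (intro tendsto_intros lim) (use pos in auto)
  then have U: "(U \<longlongrightarrow> sqrt (M / m)) (at_right 0)" by (simp add: eqs(1))
  have ev: "\<forall>\<^sub>F h in at_right 0. h > 0 \<and> P h > 0 \<and> F h > 0 \<and> 2 * F h * sqrt h \<le> U h \<and> P h \<le> 2 * F h * m \<and> bl h \<le> 2 * h * F h * P h"
    using h0 P \<delta> sol min K zm zM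
  proof eventually_elim
    case (elim h)
    have Fh: "F h > 0" unfolding F_def
      using elim(3) by (intro divide_pos_pos add_pos_nonneg) (auto simp: abs_square_less_1)
    have *: "(P h)\<^sup>2 + (cmod z)\<^sup>2 \<le> 2 * F h * (P h * Re z)" if "z \<in> K h" for z
      using elim(3,4) that unfolding F_def by (simp add: cmod_real_diff_le_iff)
    have "K h \<noteq> {}" using elim(7) by blast
    then have "2 * F h * sqrt h \<le> U h"
      unfolding F_def U_def
      by (intro robin_deviation_upper[where K = "K h"]) (use elim(1,3,5,6) pos in blast)+
    moreover obtain z where z: "z \<in> K h" "Re z = m" using elim(7) by blast
    have "(P h)\<^sup>2 \<le> 2 * F h * (P h * m)" using *[OF z(1)] z(2) by (smt (verit) zero_le_power2)
    then have "P h * P h \<le> P h * (2 * F h * m)" by (simp add: power2_eq_square algebra_simps)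
    then have "P h \<le> 2 * F h * m" using elim(2) by (simp only: mult_le_cancel_left_pos)
    moreover obtain y where y: "y \<in> K h" "bl h * Re y \<le> h * (cmod y)\<^sup>2" using elim(8) by blast
    have "Re y > 0" using elim(6) y(1) pos by fastforce
    have "(cmod y)\<^sup>2 \<le> 2 * F h * (P h * Re y)" using *[OF y(1)] by (smt (verit) zero_le_power2)
    then have "h * (cmod y)\<^sup>2 \<le> h * (2 * F h * (P h * Re y))"
      using elim(1) by (intro mult_left_mono) auto
    then have "bl h * Re y \<le> (2 * h * F h * P h) * Re y" using y(2) by (simp add: algebra_simps)
    then have "bl h \<le> 2 * h * F h * P h" using \<open>Re y > 0\<close> by (simp only: mult_le_cancel_right_pos)
    ultimately show ?case using elim(1,2) Fh by blast
  qed
  have mU: "((\<lambda>h. m * U h) \<longlongrightarrow> sqrt (m * M)) (at_right 0)"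
    unfolding eqs(3)[symmetric] by (intro tendsto_intros U)
  have blU: "((\<lambda>h. bl h / U h) \<longlongrightarrow> sqrt (m * M)) (at_right 0)"
    unfolding eqs(2)[symmetric] by (intro tendsto_intros U lim) (use pos in auto)
  show Plim: "((\<lambda>h. P h * sqrt h) \<longlongrightarrow> sqrt (m * M)) (at_right 0)"
  proof (rule tendsto_sandwich[OF _ _ blU mU])
    show "\<forall>\<^sub>F h in at_right 0. P h * sqrt h \<le> m * U h"
      using ev
    proof eventually_elim
      case (elim h)
      have "P h * sqrt h \<le> 2 * F h * m * sqrt h" using elim by (intro mult_right_mono) auto
      also have "\<dots> = m * (2 * F h * sqrt h)" by simp
      also have "\<dots> \<le> m * U h" using elim pos by (intro mult_left_mono) auto
      finally show ?case .
    qed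
    show "\<forall>\<^sub>F h in at_right 0. bl h / U h \<le> P h * sqrt h"
      using ev
    proof eventually_elim
      case (elim h)
      have "0 < 2 * F h * sqrt h" using elim by simp
      then have U0: "U h > 0" using elim by linarith
      have "bl h \<le> 2 * h * F h * P h" using elim by simp
      also have "\<dots> = (2 * F h * sqrt h) * (P h * sqrt h)" using elim by simp
      also have "\<dots> \<le> U h * (P h * sqrt h)" using elim by (intro mult_right_mono) auto
      finally show ?case using U0 by (simp add: field_simps)
    qed
  qed
  have Flim: "((\<lambda>h. F h * sqrt h) \<longlongrightarrow> sqrt (M / m) / 2) (at_right 0)"
  proof (rule tendsto_sandwich)
    show "((\<lambda>h. P h * sqrt h / (2 * m)) \<longlongrightarrow> sqrt (M / m) / 2) (at_right 0)"
      unfolding eqs(4)[symmetric] by (intro tendsto_intros Plim) (use pos in auto)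
    show "((\<lambda>h. U h / 2) \<longlongrightarrow> sqrt (M / m) / 2) (at_right 0)" by (intro tendsto_intros U) auto
    show "\<forall>\<^sub>F h in at_right 0. F h * sqrt h \<le> U h / 2" using ev by eventually_elim auto
    show "\<forall>\<^sub>F h in at_right 0. P h * sqrt h / (2 * m) \<le> F h * sqrt h"
      using ev
    proof eventually_elim
      case (elim h)
      have "P h * sqrt h \<le> 2 * F h * m * sqrt h" using elim by (intro mult_right_mono) auto
      then show ?case using pos by (simp add: field_simps)
    qed
  qed
  have "((\<lambda>h. sqrt h * 2 / (F h * sqrt h)) \<longlongrightarrow> sqrt 0 * 2 / (sqrt (M / m) / 2)) (at_right 0)"
    by (intro tendsto_intros Flim) (use pos in auto)
  then have z: "((\<lambda>h. sqrt h * 2 / (F h * sqrt h)) \<longlongrightarrow> 0) (at_right 0)" by simp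
  have "((\<lambda>h. 1 - \<delta> h) \<longlongrightarrow> 0) (at_right 0)"
  proof (rule tendsto_sandwich[OF _ _ tendsto_const z])
    show "\<forall>\<^sub>F h in at_right 0. 0 \<le> 1 - \<delta> h" using \<delta> by eventually_elim auto
    show "\<forall>\<^sub>F h in at_right 0. 1 - \<delta> h \<le> sqrt h * 2 / (F h * sqrt h)"
      using \<delta> ev
    proof eventually_elim
      case (elim h)
      have d: "(\<delta> h)\<^sup>2 < 1" using elim(1) by (simp add: abs_square_less_1)
      have d': "(\<delta> h)\<^sup>2 \<le> \<delta> h" using elim(1) by (simp add: power2_eq_square mult_left_le)
      have "(1 - \<delta> h) * F h \<le> (1 - (\<delta> h)\<^sup>2) * F h" using d' elim(2) by (intro mult_right_mono) auto
      also have "\<dots> = 1 + (\<delta> h)\<^sup>2" using d by (simp add: F_def)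
      also have "\<dots> \<le> 2" using d by simp
      finally show ?case using elim(2) by (simp add: field_simps)
    qed
  qed
  then have "((\<lambda>h. 1 - (1 - \<delta> h)) \<longlongrightarrow> 1 - 0) (at_right 0)" by (intro tendsto_intros)
  then have \<delta>1: "(\<delta> \<longlongrightarrow> 1) (at_right 0)" by simp
  \<comment> \<open>Solving the definition of \<open>F\<close> for \<open>1 - \<delta>\<close> gives
    \<open>(1 + \<delta>\<^sup>2) / ((1 + \<delta>) * F)\<close>, and the part without
    \<open>F\<close> tends to 1 because \<open>\<delta>\<close> does.\<close>
  have "((\<lambda>h. (1 + (\<delta> h)\<^sup>2) / (1 + \<delta> h) / (F h * sqrt h)) \<longlongrightarrow> (1 + 1\<^sup>2) / (1 + 1) / (sqrt (M / m) / 2)) (at_right 0)"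
    by (intro tendsto_intros Flim \<delta>1) (use pos in auto)
  then have "((\<lambda>h. (1 + (\<delta> h)\<^sup>2) / (1 + \<delta> h) / (F h * sqrt h)) \<longlongrightarrow> 2 * sqrt (m / M)) (at_right 0)"
    using eqs(5) by simp
  moreover have "\<forall>\<^sub>F h in at_right 0. (1 + (\<delta> h)\<^sup>2) / (1 + \<delta> h) / (F h * sqrt h) = (1 - \<delta> h) / sqrt h"
    using \<delta> ev
  proof eventually_elim
    case (elim h)
    have d: "(\<delta> h)\<^sup>2 < 1" using elim(1) by (auto simp: abs_square_less_1)
    have "1 + (\<delta> h)\<^sup>2 = (1 - (\<delta> h)\<^sup>2) * F h" using d by (simp add: F_def)
    also have "1 - (\<delta> h)\<^sup>2 = (1 - \<delta> h) * (1 + \<delta> h)" by (simp add: power2_eq_square algebra_simps)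
    finally have "(1 + (\<delta> h)\<^sup>2) / (1 + \<delta> h) = (1 - \<delta> h) * F h" using elim(1) by (simp add: field_simps)
    then show ?case using elim(2) by simp
  qed
  ultimately show "((\<lambda>h. (1 - \<delta> h) / sqrt h) \<longlongrightarrow> 2 * sqrt (m / M)) (at_right 0)"
    by (rule Lim_transform_eventually)
qed

section \<open>Low frequencies: the constant A\<close>

text \<open>The real part of the principal square root of the complex number with parts
  \<open>X\<close> and \<open>Y\<close>.\<close>

definition re_sqrt :: "real \<Rightarrow> real \<Rightarrow> real" where
  "re_sqrt X Y = sqrt ((sqrt (X\<^sup>2 + Y\<^sup>2) + X) / 2)"

lemma sqrt_sum_squares_ge_left: "X \<le> sqrt (X\<^sup>2 + Y\<^sup>2)"
  by (simp add: real_le_rsqrt)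

lemma re_sqrt_mono:
  assumes "0 \<le> X" "X \<le> X'" "\<bar>Y\<bar> \<le> \<bar>Y'\<bar>"
  shows "re_sqrt X Y \<le> re_sqrt X' Y'"
proof -
  have "X\<^sup>2 \<le> X'\<^sup>2" "Y\<^sup>2 \<le> Y'\<^sup>2" using assms by (simp_all add: power_mono abs_le_square_iff)
  then have "sqrt (X\<^sup>2 + Y\<^sup>2) \<le> sqrt (X'\<^sup>2 + Y'\<^sup>2)" by simp
  then have "sqrt (X\<^sup>2 + Y\<^sup>2) + X \<le> sqrt (X'\<^sup>2 + Y'\<^sup>2) + X'" using assms(2) by linarith
  then show ?thesis
    unfolding re_sqrt_def by (intro real_sqrt_le_mono divide_right_mono) auto
qed

text \<open>Eliminating \<open>y\<close> from \<open>x\<^sup>2 - y\<^sup>2 = X\<close> and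
  \<open>2 * x * y = Y\<close> leaves an equation in \<open>T = x\<^sup>2\<close>: the level curves
  are the parabolas \<open>Y\<^sup>2 = 4 * T * (T - X)\<close>. The next two lemmas decide on which
  side of such a parabola a point lies.\<close>

lemma re_sqrt_power4: "4 * ((re_sqrt X Y)\<^sup>2)\<^sup>2 = Y\<^sup>2 + 4 * (re_sqrt X Y)\<^sup>2 * X"
proof -
  define R where "R = sqrt (X\<^sup>2 + Y\<^sup>2)"
  have R: "R\<^sup>2 = X\<^sup>2 + Y\<^sup>2" by (simp add: R_def)
  have "- X \<le> R" unfolding R_def by (metis power2_minus sqrt_sum_squares_ge_left)
  then have "(re_sqrt X Y)\<^sup>2 = (R + X) / 2" by (simp add: re_sqrt_def R_def)
  moreover have "4 * ((R + X) / 2)\<^sup>2 = Y\<^sup>2 + 4 * ((R + X) / 2) * X"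
    using R by (simp add: field_simps power2_eq_square)
  ultimately show ?thesis by metis
qed

lemma le_re_sqrt:
  assumes "4 * T\<^sup>2 \<le> Y\<^sup>2 + 4 * T * X"
  shows "sqrt T \<le> re_sqrt X Y"
proof -
  have "(2 * T - X)\<^sup>2 \<le> X\<^sup>2 + Y\<^sup>2" using assms by (simp add: power2_eq_square algebra_simps)
  then have "2 * T - X \<le> sqrt (X\<^sup>2 + Y\<^sup>2)" by (rule real_le_rsqrt)
  then show ?thesis by (simp add: re_sqrt_def)
qed

lemma re_sqrt_le:
  assumes "4 * T\<^sup>2 \<ge> Y\<^sup>2 + 4 * T * X" "T > 0"
  shows "re_sqrt X Y \<le> sqrt T"
proof -
  \<comment> \<open>This forces \<open>X \<le> T\<close>, hence \<open>2 * T - X\<close> is positive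
    and comparing squares is legitimate.\<close>
  have "4 * T * X \<le> 4 * T * T" using assms(1) zero_le_power2[of Y] unfolding power2_eq_square[of T] by linarith
  then have "X \<le> T" using assms(2) by simp
  moreover have "X\<^sup>2 + Y\<^sup>2 \<le> (2 * T - X)\<^sup>2" using assms(1) by (simp add: power2_eq_square algebra_simps)
  ultimately have "sqrt (X\<^sup>2 + Y\<^sup>2) \<le> 2 * T - X" using assms(2) by (intro real_le_lsqrt) auto
  then show ?thesis by (simp add: re_sqrt_def)
qed

lemma phi_eq_re_sqrt: "phi \<nu> a b k \<xi> = 4 * re_sqrt (x0sq \<nu> a b + 4 * \<nu>\<^sup>2 * k\<^sup>2) (4 * \<nu> * \<xi>)"
proof -
  have "4 * sqrt (x / 2) = 2 * sqrt 2 * sqrt x" for x :: real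
    by (simp add: real_sqrt_divide field_simps)
  then show ?thesis
    unfolding phi_def re_sqrt_def by (simp add: power_mult_distrib add.assoc)
qed

text \<open>\<open>kbar\<close> is the vertex of the quadratic in \<open>k\<close> expressing that the real part is at least
  \<open>sqrt T\<close>, for the one \<open>T\<close> at which that quadratic has a double root.\<close>

lemma kbar_vertex:
  assumes "\<nu> > 0" "b \<ge> 0" "\<omega>m > 0"
  obtains T where "T > 0" "kbar \<nu> a b c \<omega>m \<ge> 0" "(c\<^sup>2 + T) * kbar \<nu> a b c \<omega>m = \<bar>c\<bar> * \<omega>m"
    "\<And>k. (4 * \<nu> * (\<omega>m - \<bar>c\<bar> * k))\<^sup>2 + 4 * T * (x0sq \<nu> a b + 4 * \<nu>\<^sup>2 * k\<^sup>2) - 4 * T\<^sup>2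
      = 16 * \<nu>\<^sup>2 * (c\<^sup>2 + T) * (k - kbar \<nu> a b c \<omega>m)\<^sup>2"
proof -
  define X where "X = x0sq \<nu> a b"
  define C where "C = \<bar>c\<bar>"
  have cC: "c\<^sup>2 = C\<^sup>2" by (simp add: C_def)
  have X: "X \<ge> 0" using assms by (simp add: X_def x0sq_def)
  define S where "S = sqrt ((C\<^sup>2 + X)\<^sup>2 + 16 * \<nu>\<^sup>2 * \<omega>m\<^sup>2)"
  have S2: "S\<^sup>2 = (C\<^sup>2 + X)\<^sup>2 + 16 * \<nu>\<^sup>2 * \<omega>m\<^sup>2" by (simp add: S_def)
  have "sqrt ((C\<^sup>2 + X)\<^sup>2) < S" unfolding S_def using assms by (intro real_sqrt_less_mono) simp
  then have S: "C\<^sup>2 + X < S" using X by simp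
  \<comment> \<open>The positive root of \<open>(T - X) * (C\<^sup>2 + T) = 4 * \<nu>\<^sup>2 *
    \<omega>m\<^sup>2\<close>, which is the vanishing of the discriminant of the quadratic in
    \<open>k\<close>.\<close>
  define T where "T = (X - C\<^sup>2 + S) / 2"
  define K where "K = kbar \<nu> a b c \<omega>m"
  have K: "K = C * (S - (C\<^sup>2 + X)) / (8 * \<nu>\<^sup>2 * \<omega>m)"
    unfolding K_def kbar_def S_def X_def cC C_def[symmetric] by (simp add: C_def)
  have T: "T > 0" using S X unfolding T_def by simp
  have CT: "C\<^sup>2 + T = (C\<^sup>2 + X + S) / 2" by (simp add: T_def field_simps)
  have K0: "K \<ge> 0" unfolding K using S assms by (simp add: C_def)
  have vertex: "(C\<^sup>2 + T) * K = C * \<omega>m"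
  proof -
    have "(C\<^sup>2 + T) * K = C * (S\<^sup>2 - (C\<^sup>2 + X)\<^sup>2) / (16 * \<nu>\<^sup>2 * \<omega>m)"
      unfolding CT K using assms by (simp add: field_simps power2_eq_square)
    also have "\<dots> = C * \<omega>m" unfolding S2 using assms by (simp add: field_simps power2_eq_square)
    finally show ?thesis .
  qed
  have T2: "(T - X) * (C\<^sup>2 + T) = 4 * \<nu>\<^sup>2 * \<omega>m\<^sup>2"
  proof -
    have "(T - X) * (C\<^sup>2 + T) = (S\<^sup>2 - (C\<^sup>2 + X)\<^sup>2) / 4"
      unfolding CT T_def by (simp add: field_simps power2_eq_square)
    then show ?thesis unfolding S2 by simp
  qed
  have const: "16 * \<nu>\<^sup>2 * \<omega>m\<^sup>2 + 4 * T * X - 4 * T\<^sup>2 = 16 * \<nu>\<^sup>2 * (C\<^sup>2 + T) * K\<^sup>2"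
  proof -
    have pos: "C\<^sup>2 + T > 0" using T by (simp add: add_nonneg_pos)
    have "(16 * \<nu>\<^sup>2 * \<omega>m\<^sup>2 + 4 * T * X - 4 * T\<^sup>2) * (C\<^sup>2 + T)
        = 16 * \<nu>\<^sup>2 * \<omega>m\<^sup>2 * (C\<^sup>2 + T) - 4 * T * ((T - X) * (C\<^sup>2 + T))"
      by (simp add: algebra_simps power2_eq_square)
    also have "\<dots> = 16 * \<nu>\<^sup>2 * (C * \<omega>m)\<^sup>2" unfolding T2 by (simp add: algebra_simps power2_eq_square)
    also have "\<dots> = (16 * \<nu>\<^sup>2 * (C\<^sup>2 + T) * K\<^sup>2) * (C\<^sup>2 + T)"
      unfolding vertex[symmetric] by (simp add: power2_eq_square)
    finally show ?thesis using pos by simp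
  qed
  show thesis
  proof (rule that[OF T, folded K_def])
    show "K \<ge> 0" by (fact K0)
    show "(c\<^sup>2 + T) * K = \<bar>c\<bar> * \<omega>m" using vertex by (simp add: C_def)
    fix k
    have "(4 * \<nu> * (\<omega>m - C * k))\<^sup>2 + 4 * T * (X + 4 * \<nu>\<^sup>2 * k\<^sup>2) - 4 * T\<^sup>2
      = 16 * \<nu>\<^sup>2 * (C\<^sup>2 + T) * k\<^sup>2 - 32 * \<nu>\<^sup>2 * (C * \<omega>m) * k + (16 * \<nu>\<^sup>2 * \<omega>m\<^sup>2 + 4 * T * X - 4 * T\<^sup>2)"
      by (simp add: algebra_simps power2_eq_square)
    also have "\<dots> = 16 * \<nu>\<^sup>2 * (C\<^sup>2 + T) * (k - K)\<^sup>2"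
      unfolding const vertex[symmetric] by (simp add: algebra_simps power2_eq_square)
    finally show "(4 * \<nu> * (\<omega>m - \<bar>c\<bar> * k))\<^sup>2 + 4 * T * (x0sq \<nu> a b + 4 * \<nu>\<^sup>2 * k\<^sup>2) - 4 * T\<^sup>2
      = 16 * \<nu>\<^sup>2 * (c\<^sup>2 + T) * (k - K)\<^sup>2" by (simp add: C_def X_def)
  qed
qed

text \<open>While \<open>\<bar>c\<bar> * \<bar>k\<bar> \<le> \<omega>m\<close>, the imaginary part
  is smallest in modulus on the edge \<open>\<bar>\<omega>\<bar> = \<omega>m\<close>, where the real
  part of the root is at least \<open>sqrt T\<close>, with equality at \<open>kbar\<close>, and
  increases to the right of \<open>kbar\<close>. For larger \<open>\<bar>k\<bar>\<close> the
  imaginary part can vanish, and what remains is the square root of the real part, increasing in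
  \<open>\<bar>k\<bar>\<close>. The factor 4 is the normalization of \<open>phi\<close>.\<close>

lemma constA_le_re_sqrt:
  assumes "\<nu> > 0" "b \<ge> 0" "km \<ge> 0" "\<omega>m > 0" "\<omega>m \<le> \<bar>\<omega>\<bar>" "km \<le> \<bar>k\<bar>"
  shows "constA \<nu> a b c km \<omega>m / 4 \<le> re_sqrt (x0sq \<nu> a b + 4 * \<nu>\<^sup>2 * k\<^sup>2) (4 * \<nu> * (\<omega> + c * k))"
proof -
  define X where "X k = x0sq \<nu> a b + 4 * \<nu>\<^sup>2 * k\<^sup>2" for k
  define K where "K = kbar \<nu> a b c \<omega>m"
  define C where "C = \<bar>c\<bar>"
  have C0: "C \<ge> 0" by (simp add: C_def)
  have X0: "X k \<ge> 0" for k using assms by (simp add: X_def x0sq_def)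
  have Xmono: "X k \<le> X k'" if "0 \<le> k" "k \<le> k'" for k k'
    using that assms by (simp add: X_def power_mono)
  obtain T where T: "T > 0" "K \<ge> 0" "(C\<^sup>2 + T) * K = C * \<omega>m"
    "\<And>k. (4 * \<nu> * (\<omega>m - C * k))\<^sup>2 + 4 * T * X k - 4 * T\<^sup>2 = 16 * \<nu>\<^sup>2 * (C\<^sup>2 + T) * (k - K)\<^sup>2"
    by (rule kbar_vertex[OF assms(1,2,4), of a c]) (simp add: K_def C_def X_def)
  define f where "f k = re_sqrt (X k) (4 * \<nu> * (\<omega>m - C * k))" for k
  have A: "constA \<nu> a b c km \<omega>m / 4 = (if km \<le> K then f K else if C * km \<le> \<omega>m then f km else re_sqrt (X km) 0)"
    unfolding constA_def Let_def K_def[symmetric] C_def[symmetric] f_def phi_eq_re_sqrt X_def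
    by (simp add: re_sqrt_def power_mult_distrib power2_commute[of "\<omega>m"])
  have fge: "sqrt T \<le> f k" for k
  proof -
    have "0 \<le> 16 * \<nu>\<^sup>2 * (C\<^sup>2 + T) * (k - K)\<^sup>2" using T(1) by (simp add: add_nonneg_nonneg)
    then show ?thesis unfolding f_def by (intro le_re_sqrt) (use T(4)[of k] in linarith)
  qed
  have fK: "f K \<le> sqrt T"
    unfolding f_def by (rule re_sqrt_le) (use T(1) T(4)[of K] in simp_all)
  have fmono: "f km \<le> f k" if "K \<le> km" "km \<le> k" for k
  proof -
    \<comment> \<open>At the level \<open>T'\<close> reached at \<open>km\<close> the quadratic in
      \<open>k\<close> has its vertex at \<open>C * \<omega>m / (C\<^sup>2 + T')\<close>. Since
      \<open>T' \<ge> T\<close>, this is at most \<open>K\<close>, so the quadratic increases from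
      \<open>km\<close> to \<open>k\<close>.\<close>
    define T' where "T' = (f km)\<^sup>2"
    have f0: "f km \<ge> 0" using fge[of km] T(1) by (smt (verit) real_sqrt_gt_zero)
    have "(sqrt T)\<^sup>2 \<le> T'" unfolding T'_def using fge[of km] T(1) by (intro power_mono) auto
    then have "T \<le> T'" using T(1) by simp
    have "4 * T'\<^sup>2 = (4 * \<nu> * (\<omega>m - C * km))\<^sup>2 + 4 * T' * X km"
      unfolding T'_def f_def by (rule re_sqrt_power4)
    also have "\<dots> \<le> (4 * \<nu> * (\<omega>m - C * k))\<^sup>2 + 4 * T' * X k"
    proof -
      have "C * \<omega>m \<le> (C\<^sup>2 + T') * km"
        unfolding T(3)[symmetric] using \<open>T \<le> T'\<close> that T(1,2) by (intro mult_mono) auto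
      moreover have "(C\<^sup>2 + T') * km \<le> (C\<^sup>2 + T') * k" 
        using that \<open>T \<le> T'\<close> T(1) by (intro mult_left_mono) auto
      ultimately have "0 \<le> 16 * \<nu>\<^sup>2 * (k - km) * ((C\<^sup>2 + T') * (k + km) - 2 * (C * \<omega>m))"
        using that by (intro mult_nonneg_nonneg) (auto simp: algebra_simps)
      also have "\<dots> = (4 * \<nu> * (\<omega>m - C * k))\<^sup>2 + 4 * T' * X k - ((4 * \<nu> * (\<omega>m - C * km))\<^sup>2 + 4 * T' * X km)"
        unfolding X_def by (simp add: algebra_simps power2_eq_square)
      finally show ?thesis by simp
    qed
    finally have "sqrt T' \<le> f k" unfolding f_def by (rule le_re_sqrt)
    then show ?thesis using f0 by (simp add: T'_def)
  qed
  have near: "constA \<nu> a b c km \<omega>m / 4 \<le> f k" if "km \<le> k" "C * k \<le> \<omega>m" for k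
  proof -
    have "C * km \<le> \<omega>m" using that mult_left_mono[OF that(1) C0] by linarith
    then show ?thesis unfolding A using fK fge[of k] fmono[OF _ that(1)] by auto
  qed
  have "constA \<nu> a b c km \<omega>m / 4 \<le> re_sqrt (X \<bar>k\<bar>) (4 * \<nu> * (\<omega> + c * k))"
  proof (cases "C * \<bar>k\<bar> \<le> \<omega>m")
    case True
    note near[OF assms(6) True]
    also have "f \<bar>k\<bar> \<le> re_sqrt (X \<bar>k\<bar>) (4 * \<nu> * (\<omega> + c * k))"
    proof -
      have "\<bar>\<omega>\<bar> - \<bar>c * k\<bar> \<le> \<bar>\<omega> + c * k\<bar>" by linarith
      then have "\<bar>\<omega>m - C * \<bar>k\<bar>\<bar> \<le> \<bar>\<omega> + c * k\<bar>" using True assms(5) by (simp add: C_def abs_mult)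
      then show ?thesis unfolding f_def using X0 assms(1) by (intro re_sqrt_mono) (auto simp: abs_mult)
    qed
    finally show ?thesis .
  next
    case False
    have zero: "re_sqrt (X k') 0 \<le> re_sqrt (X \<bar>k\<bar>) (4 * \<nu> * (\<omega> + c * k))" if "0 \<le> k'" "k' \<le> \<bar>k\<bar>" for k'
      by (rule re_sqrt_mono) (use X0 Xmono that in auto)
    show ?thesis
    proof (cases "C * km \<le> \<omega>m")
      case True
      have "C > 0" using False assms(4) C0 by (metis less_eq_real_def mult_zero_left)
      then have "km \<le> \<omega>m / C" "\<omega>m / C \<le> \<bar>k\<bar>" using True False by (simp_all add: field_simps)
      moreover have "f (\<omega>m / C) = re_sqrt (X (\<omega>m / C)) 0" using \<open>C > 0\<close> by (simp add: f_def)
      ultimately show ?thesis using near[of "\<omega>m / C"] zero[of "\<omega>m / C"] \<open>C > 0\<close> assms(3) by simp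
    next
      case F: False
      \<comment> \<open>The vertex comes no later than the zero of the imaginary part, so here
        \<open>km\<close> exceeds \<open>K\<close> and the last branch of \<open>constA\<close>
        applies.\<close>
      have "C * K \<le> \<omega>m"
      proof (cases "C = 0")
        case nz: False
        have "C * (C * K) \<le> (C\<^sup>2 + T) * K" using T(1,2) by (simp add: power2_eq_square algebra_simps)
        then show ?thesis unfolding T(3) using nz C0 by simp
      qed (use assms in simp)
      then have "\<not> km \<le> K" using F C0 by (meson mult_left_mono order_trans)
      then have "constA \<nu> a b c km \<omega>m / 4 = re_sqrt (X km) 0" unfolding A using F by simp
      then show ?thesis using zero[OF assms(3,6)] by simp
    qed
  qed
  then show ?thesis by (simp add: X_def)
qed

text \<open>The sign of \<open>k\<close> is chosen so that
  \<open>c * k = \<bar>c\<bar> * \<bar>k\<bar>\<close>, and \<open>\<omega>\<close> is negative to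
  oppose it; when \<open>\<bar>c\<bar> * km\<close> exceeds \<open>\<omega>m\<close>,
  \<open>\<omega>\<close> can cancel the drift exactly. Upper cut-offs are absent because a fixed
  frequency pair passes them for all small \<open>h\<close>.\<close>

lemma constA_attained:
  assumes "\<nu> > 0" "b \<ge> 0" "km \<ge> 0" "\<omega>m > 0"
  obtains \<omega> k where "\<omega>m \<le> \<bar>\<omega>\<bar>" "km \<le> \<bar>k\<bar>"
    "re_sqrt (x0sq \<nu> a b + 4 * \<nu>\<^sup>2 * k\<^sup>2) (4 * \<nu> * (\<omega> + c * k)) = constA \<nu> a b c km \<omega>m / 4"
proof -
  define K where "K = kbar \<nu> a b c \<omega>m"
  define s where "s = (if c \<ge> 0 then 1 else - 1 :: real)"
  have s: "c * (s * k) = \<bar>c\<bar> * k" "(s * k)\<^sup>2 = k\<^sup>2" "\<bar>s * k\<bar> = \<bar>k\<bar>" for k by (auto simp: s_def)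
  have A: "constA \<nu> a b c km \<omega>m / 4 = 
    (if km \<le> K then re_sqrt (x0sq \<nu> a b + 4 * \<nu>\<^sup>2 * K\<^sup>2) (4 * \<nu> * (- \<omega>m + \<bar>c\<bar> * K))
     else if \<bar>c\<bar> * km \<le> \<omega>m then re_sqrt (x0sq \<nu> a b + 4 * \<nu>\<^sup>2 * km\<^sup>2) (4 * \<nu> * (- \<omega>m + \<bar>c\<bar> * km))
     else re_sqrt (x0sq \<nu> a b + 4 * \<nu>\<^sup>2 * km\<^sup>2) (4 * \<nu> * 0))"
    unfolding constA_def Let_def K_def[symmetric] phi_eq_re_sqrt by simp
  consider "km \<le> K" | "\<not> km \<le> K" "\<bar>c\<bar> * km \<le> \<omega>m" | "\<not> km \<le> K" "\<not> \<bar>c\<bar> * km \<le> \<omega>m" by blast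
  then show thesis
  proof cases
    case 1
    then show ?thesis using assms by (intro that[of "- \<omega>m" "s * K"]) (simp_all add: A s del: mult_minus_right)
  next
    case 2
    then show ?thesis using assms by (intro that[of "- \<omega>m" "s * km"]) (simp_all add: A s)
  next
    case 3
    then show ?thesis using assms by (intro that[of "- (\<bar>c\<bar> * km)" "s * km"]) (simp_all add: A s)
  qed
qed

section \<open>High frequencies: the constant B\<close>

lemma re_sqrt_pos:
  assumes "X \<ge> 0" "X \<noteq> 0 \<or> Y \<noteq> 0"
  shows "re_sqrt X Y > 0"
proof -
  have "sqrt (X\<^sup>2 + Y\<^sup>2) > 0" using assms by (auto simp: add_pos_nonneg add_nonneg_pos)
  then show ?thesis unfolding re_sqrt_def using assms by (simp add: add_pos_nonneg)
qed

text \<open>The ratio \<open>(cmod z)\<^sup>2 / Re z\<close> for the principal root \<open>z\<close>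
  of the complex number with parts \<open>X\<close> and \<open>Y\<close>; division by zero gives 0
  at the origin.\<close>

definition gain :: "real \<Rightarrow> real \<Rightarrow> real" where
  "gain X Y = sqrt (X\<^sup>2 + Y\<^sup>2) / re_sqrt X Y"

lemma gain_eq_sqrt:
  "gain X Y = sqrt (2 * (X\<^sup>2 + Y\<^sup>2) / (sqrt (X\<^sup>2 + Y\<^sup>2) + X))"
  unfolding gain_def re_sqrt_def by (simp flip: real_sqrt_divide add: algebra_simps)

lemma gain_zero_left: "gain 0 Y = sqrt (2 * \<bar>Y\<bar>)"
  unfolding gain_eq_sqrt by (cases "Y = 0") (simp_all add: power2_eq_square abs_if)

lemma gain_zero_right: "X \<ge> 0 \<Longrightarrow> gain X 0 = sqrt X"
  unfolding gain_eq_sqrt by (cases "X = 0") (simp_all add: power2_eq_square)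

text \<open>Homogeneity of degree 1/2: scaling by \<open>h\<^sup>2\<close> brings the growing
  frequency range into a bounded region and produces the factor \<open>h\<close>.\<close>

lemma gain_scale:
  assumes "h > 0"
  shows "gain (h\<^sup>2 * X) (h\<^sup>2 * Y) = h * gain X Y"
proof -
  have R: "sqrt ((h\<^sup>2 * X)\<^sup>2 + (h\<^sup>2 * Y)\<^sup>2) = h\<^sup>2 * sqrt (X\<^sup>2 + Y\<^sup>2)"
    by (rule real_sqrt_unique) (simp_all add: power_mult_distrib algebra_simps)
  have "re_sqrt (h\<^sup>2 * X) (h\<^sup>2 * Y) = sqrt (h\<^sup>2 * ((sqrt (X\<^sup>2 + Y\<^sup>2) + X) / 2))"
    unfolding re_sqrt_def R by (simp add: algebra_simps)
  also have "\<dots> = h * re_sqrt X Y"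
    using assms by (simp only: real_sqrt_mult re_sqrt_def) simp
  finally show ?thesis unfolding gain_def R using assms by (simp add: power2_eq_square)
qed

lemma tendsto_gain:
  assumes "(X \<longlongrightarrow> x) F" "(Y \<longlongrightarrow> y) F" "x \<ge> 0" "x \<noteq> 0 \<or> y \<noteq> 0"
  shows "((\<lambda>h. gain (X h) (Y h)) \<longlongrightarrow> gain x y) F"
proof -
  have "re_sqrt x y \<noteq> 0" using re_sqrt_pos[OF assms(3,4)] by simp
  then show ?thesis
    unfolding gain_def re_sqrt_def by (intro tendsto_intros assms) auto
qed

text \<open>For fixed \<open>X \<ge> 0\<close> the squared gain is
  \<open>2 * R\<^sup>2 / (R + X)\<close>, which increases with the modulus \<open>R\<close>.\<close>

lemma gain_mono_right:
  assumes "X \<ge> 0" "\<bar>Y\<bar> \<le> Y'"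
  shows "gain X Y \<le> gain X Y'"
proof (cases "X = 0 \<and> Y = 0")
  case True
  then show ?thesis using assms by (simp add: gain_zero_left)
next
  case False
  define R where "R = sqrt (X\<^sup>2 + Y\<^sup>2)"
  define R' where "R' = sqrt (X\<^sup>2 + Y'\<^sup>2)"
  have "R > 0" unfolding R_def using False by (auto simp: add_pos_nonneg add_nonneg_pos)
  have "Y\<^sup>2 \<le> Y'\<^sup>2" using assms by (metis abs_ge_zero power2_abs power_mono)
  then have "R \<le> R'" unfolding R_def R'_def by simp
  have "R\<^sup>2 * (R' + X) \<le> R'\<^sup>2 * (R + X)"
  proof -
    have "0 \<le> R * R' * (R' - R) + X * (R' - R) * (R' + R)"
      using \<open>R \<le> R'\<close> \<open>R > 0\<close> assms(1) by (intro add_nonneg_nonneg mult_nonneg_nonneg) auto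
    then show ?thesis by (simp add: power2_eq_square algebra_simps)
  qed
  then have "R\<^sup>2 / (R + X) \<le> R'\<^sup>2 / (R' + X)"
    using \<open>R \<le> R'\<close> \<open>R > 0\<close> assms(1) by (simp add: divide_simps)
  then have "2 * R\<^sup>2 / (R + X) \<le> 2 * R'\<^sup>2 / (R' + X)" by simp
  then show ?thesis unfolding gain_eq_sqrt by (simp add: R_def R'_def)
qed

text \<open>In the variable \<open>v = sqrt (X\<^sup>2 + Y\<^sup>2) + X\<close> the square of the gain is the convex function
  \<open>(v + 2 * Y\<^sup>2 / v + Y ^ 4 / v ^ 3) / 2\<close>.\<close>

lemma gain_le_max:
  assumes "0 \<le> X" "X \<le> X'" "Y > 0"
  shows "gain X Y \<le> max (gain 0 Y) (gain X' Y)"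
proof -
  define f where "f v = (v + 2 * Y\<^sup>2 / v + Y ^ 4 / v ^ 3) / 2" for v :: real
  define v where "v X = sqrt (X\<^sup>2 + Y\<^sup>2) + X" for X
  have v0: "v X > 0" if "X \<ge> 0" for X
    unfolding v_def using that assms(3) by (intro add_pos_nonneg) (auto simp: add_nonneg_pos)
  have gain: "gain X Y = sqrt (f (v X))" if "X \<ge> 0" for X
  proof -
    define R where "R = sqrt (X\<^sup>2 + Y\<^sup>2)"
    have R2: "R\<^sup>2 = X\<^sup>2 + Y\<^sup>2" by (simp add: R_def)
    have pos: "R + X > 0" using v0[OF that] by (simp add: v_def R_def)
    have "Y\<^sup>2 = (R + X) * (R - X)" using R2 by (simp add: power2_eq_square algebra_simps)
    moreover have "Y ^ 4 = (Y\<^sup>2)\<^sup>2" by simp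
    ultimately have "f (R + X) = 2 * R\<^sup>2 / (R + X)"
      unfolding f_def using pos by (simp add: divide_simps) (simp add: power2_eq_square power3_eq_cube algebra_simps)
    then show ?thesis unfolding gain_eq_sqrt v_def using R2 by (simp add: R_def)
  qed
  have conv: "convex_on {0<..} f"
  proof (rule f''_ge0_imp_convex)
    show "convex {0::real<..}" by (rule convex_real_interval)
    show "(f has_real_derivative (1 - 2 * Y\<^sup>2 / v\<^sup>2 - 3 * Y ^ 4 / v ^ 4) / 2) (at v)" if "v \<in> {0<..}" for v
      unfolding f_def using that
      by - ((rule derivative_eq_intros refl | simp)+,
        simp add: divide_simps, simp add: eval_nat_numeral algebra_simps)
    show "((\<lambda>v. (1 - 2 * Y\<^sup>2 / v\<^sup>2 - 3 * Y ^ 4 / v ^ 4) / 2) has_real_derivative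
        (4 * Y\<^sup>2 / v ^ 3 + 12 * Y ^ 4 / v ^ 5) / 2) (at v)" if "v \<in> {0<..}" for v
      using that
      by - ((rule derivative_eq_intros refl | simp)+, simp add: divide_simps, simp add: eval_nat_numeral algebra_simps)
    show "(4 * Y\<^sup>2 / v ^ 3 + 12 * Y ^ 4 / v ^ 5) / 2 \<ge> 0" if "v \<in> {0<..}" for v
      using that by simp
  qed
  have mono: "v X \<le> v X'" if "0 \<le> X" "X \<le> X'" for X X'
    unfolding v_def using that assms(3) by (intro add_mono real_sqrt_le_mono power_mono) auto
  have "f (v X) \<le> max (f (v 0)) (f (v X'))"
  \<comment> \<open>The gain is not monotone in \<open>X\<close>, but \<open>v\<close> is, so
    convexity in \<open>v\<close> pushes the maximum to an end of the interval of
    \<open>X\<close>.\<close>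
  proof (rule convex_on_le_max[of "v 0" "v X'" f])
    show "convex_on {v 0..v X'} f"
      by (rule convex_on_subset[OF conv]) (use v0[of 0] in auto)
    show "v X \<in> {v 0..v X'}" using mono assms by auto
  qed
  then have "f (v X) \<le> f (v 0) \<or> f (v X) \<le> f (v X')" by linarith
  then have "sqrt (f (v X)) \<le> sqrt (f (v 0)) \<or> sqrt (f (v X)) \<le> sqrt (f (v X'))" by auto
  then show ?thesis using gain assms by (auto simp: le_max_iff_disj)
qed

section \<open>The threshold \<open>d0\<close> and the closed form of \<open>constB\<close>\<close>

lemma cubic_d0: "d < d0 \<longleftrightarrow> d ^ 3 - 2 * d\<^sup>2 + 2 * d - 2 < 0"
proof -
  define q :: "real \<Rightarrow> real" where "q d = d ^ 3 - 2 * d\<^sup>2 + 2 * d - 2" for d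
  have mono: "q x < q y" if "x < y" for x y
  proof -
    \<comment> \<open>Four times the divided difference of \<open>q\<close>, written as a sum of
      squares and a positive constant.\<close>
    have "3 * (x + y - 4 / 3)\<^sup>2 + (x - y)\<^sup>2 + 8 / 3 > 0" by (intro add_nonneg_pos add_nonneg_nonneg) auto
    then have "x * x + x * y + y * y - 2 * x - 2 * y + 2 > 0"
      by (simp add: power2_eq_square algebra_simps)
    then have "(y - x) * (x * x + x * y + y * y - 2 * x - 2 * y + 2) > 0" using that by simp
    then show ?thesis by (simp add: q_def power2_eq_square power3_eq_cube algebra_simps)
  qed
  have "\<exists>d. 1 \<le> d \<and> d \<le> 2 \<and> q d = 0"
    by (rule IVT') (auto simp: q_def intro!: continuous_intros)
  then obtain r where r: "q r = 0" by blast
  have "d0 = r"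
    unfolding d0_def
  proof (rule the_equality)
    show "r ^ 3 - 2 * r\<^sup>2 + 2 * r - 2 = 0" using r by (simp add: q_def)
    show "d = r" if "d ^ 3 - 2 * d\<^sup>2 + 2 * d - 2 = 0" for d
      using that r mono[of d r] mono[of r d] by (fastforce simp: q_def)
  qed
  then have "d < d0 \<longleftrightarrow> q d < 0" using mono[of d r] mono[of r d] r by (cases d r rule: linorder_cases) auto
  then show ?thesis by (simp add: q_def)
qed

text \<open>Multiplied by \<open>d\<close>, the cubic becomes
  \<open>(1 + d\<^sup>2 - d)\<^sup>2 - (1 + d\<^sup>2)\<close>. The resulting condition says that
  the gain at the corner is smaller than the gain at \<open>X = 0\<close>.\<close>

lemma d0_threshold:
  assumes "d > 0"
  shows "d < d0 \<longleftrightarrow> 1 + d\<^sup>2 < d + sqrt (1 + d\<^sup>2)"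
proof -
  have pos: "0 < 1 + d\<^sup>2 - d"
  proof -
    have "1 + d\<^sup>2 - d = (d - 1 / 2)\<^sup>2 + 3 / 4" by (simp add: power2_eq_square algebra_simps)
    then show ?thesis by (simp add: add_nonneg_pos)
  qed
  have "d ^ 3 - 2 * d\<^sup>2 + 2 * d - 2 < 0 \<longleftrightarrow> d * (d ^ 3 - 2 * d\<^sup>2 + 2 * d - 2) < 0"
    using assms by (simp add: mult_less_0_iff)
  also have "d * (d ^ 3 - 2 * d\<^sup>2 + 2 * d - 2) = (1 + d\<^sup>2 - d)\<^sup>2 - (1 + d\<^sup>2)"
    by (simp add: power2_eq_square power3_eq_cube algebra_simps)
  also have "\<dots> < 0 \<longleftrightarrow> sqrt ((1 + d\<^sup>2 - d)\<^sup>2) < sqrt (1 + d\<^sup>2)"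
    unfolding real_sqrt_less_iff by simp
  also have "\<dots> \<longleftrightarrow> 1 + d\<^sup>2 < d + sqrt (1 + d\<^sup>2)" using pos by (auto simp: abs_if)
  finally show ?thesis unfolding cubic_d0 .
qed

text \<open>Here \<open>4 * \<nu>\<^sup>2 * pi\<^sup>2\<close> and \<open>Y\<close> are the limits
  of the scaled real and imaginary parts at the cut-offs; for linear time steps the latter vanishes.
  With \<open>d = X / Y\<close> and \<open>s = sqrt (1 + d\<^sup>2)\<close> the corner gain is
  \<open>sqrt (s\<^sup>2 / (d + s))\<close> times the gain at \<open>X = 0\<close>, and the
  reciprocal of this factor is \<open>C\<close> when \<open>d \<ge> d0\<close>.\<close>

lemma constB_eq_gain:
  fixes quad :: bool
  assumes "\<nu> > 0" "Ch > 0"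
  defines "Y \<equiv> if quad then 4 * \<nu> * pi / Ch else 0"
  shows "max (sqrt (2 * Y)) (gain (4 * \<nu>\<^sup>2 * pi\<^sup>2) Y) = 4 / constB \<nu> quad Ch"
proof (cases quad)
  case False
  have "gain (4 * \<nu>\<^sup>2 * pi\<^sup>2) 0 = 2 * \<nu> * pi"
    using assms by (simp add: gain_zero_right real_sqrt_mult)
  then show ?thesis using False assms by (simp add: constB_def Y_def)
next
  case True
  define d where "d = \<nu> * pi * Ch"
  define s where "s = sqrt (1 + d\<^sup>2)"
  define X where "X = 4 * \<nu>\<^sup>2 * pi\<^sup>2"
  have d: "d > 0" using assms by (simp add: d_def)
  have X: "X > 0" using assms by (simp add: X_def)
  have s: "s > 0" "s\<^sup>2 = 1 + d\<^sup>2" unfolding s_def by (auto simp: add_pos_nonneg)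
  have Y: "Y = X / d" using True assms by (simp add: Y_def X_def d_def field_simps power2_eq_square)
  have XY: "X\<^sup>2 + Y\<^sup>2 = (X * s / d)\<^sup>2"
    unfolding Y using d s by (simp add: power_divide power_mult_distrib field_simps)
  have R: "sqrt (X\<^sup>2 + Y\<^sup>2) = X * s / d" unfolding XY using X s d by simp
  have ds: "X * d + X * s \<noteq> 0" using X s(1) d by (simp flip: distrib_left)
  have "2 * (X\<^sup>2 + Y\<^sup>2) / (sqrt (X\<^sup>2 + Y\<^sup>2) + X) = 2 * X / d * (s\<^sup>2 / (d + s))"
    unfolding R unfolding XY using X s(1) d ds
    by (simp add: divide_simps add_pos_pos) (simp add: power2_eq_square algebra_simps)
  then have gain: "gain X Y = sqrt (2 * X / d) * sqrt (s\<^sup>2 / (d + s))"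
    unfolding gain_eq_sqrt by (simp only: real_sqrt_mult)
  have Y2: "sqrt (2 * Y) = sqrt (2 * X / d)" by (simp add: Y)
  have base: "4 / (sqrt (2 * d) / (\<nu> * pi)) = sqrt (2 * X / d)"
  proof (rule real_sqrt_unique[symmetric])
    show "(4 / (sqrt (2 * d) / (\<nu> * pi)))\<^sup>2 = 2 * X / d"
      using d by (simp add: X_def power_divide power_mult_distrib)
  qed (use d assms in simp)
  have ds0: "d + s > 0" using d s by simp
  have iff: "d < d0 \<longleftrightarrow> s\<^sup>2 < d + s"
    unfolding s(2) using d0_threshold[OF d] by (simp add: s_def)
  show ?thesis
  proof (cases "d < d0")
    case less: True
    then have "s\<^sup>2 / (d + s) < 1" using iff ds0 by simp
    then have "sqrt (s\<^sup>2 / (d + s)) \<le> 1" by simp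
    then have "gain X Y \<le> sqrt (2 * Y)" unfolding gain Y2
      using X d by (intro mult_left_le) auto
    moreover have "4 / constB \<nu> quad Ch = sqrt (2 * Y)"
      unfolding constB_def Let_def using True less base Y2 by (simp add: d_def)
    ultimately show ?thesis by (simp add: X_def max_def)
  next
    case ge: False
    then have "1 \<le> s\<^sup>2 / (d + s)" using iff ds0 by simp
    then have "1 \<le> sqrt (s\<^sup>2 / (d + s))" by simp
    then have "sqrt (2 * Y) * 1 \<le> gain X Y" unfolding gain Y2
      using X d by (intro mult_left_mono) auto
    moreover have "4 / constB \<nu> quad Ch = gain X Y"
    proof -
      have "constB \<nu> quad Ch = sqrt ((d + s) / s\<^sup>2) * (sqrt (2 * d) / (\<nu> * pi))"
        unfolding constB_def Let_def using True ge s(2) by (simp add: d_def s_def)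
      then have "4 / constB \<nu> quad Ch = 4 / (sqrt (2 * d) / (\<nu> * pi)) * (1 / sqrt ((d + s) / s\<^sup>2))" by simp
      also have "1 / sqrt ((d + s) / s\<^sup>2) = sqrt (s\<^sup>2 / (d + s))" by (simp add: real_sqrt_divide)
      finally show ?thesis unfolding gain base .
    qed
    ultimately show ?thesis by (simp add: X_def max_def)
  qed
qed

section \<open>The frequency domain\<close>

definition symbol_root :: "real \<Rightarrow> real \<Rightarrow> real \<Rightarrow> real \<Rightarrow> real \<times> real \<Rightarrow> complex" where
  "symbol_root \<nu> a b c = (\<lambda>(\<omega>, k).
     csqrt (Complex (x0sq \<nu> a b + 4 * \<nu>\<^sup>2 * k\<^sup>2) (4 * \<nu> * (\<omega> + c * k))))"

lemma Re_csqrt_Complex: "Re (csqrt (Complex X Y)) = re_sqrt X Y"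
  by (simp add: re_sqrt_def cmod_def)

lemma cmod_csqrt_Complex: "(cmod (csqrt (Complex X Y)))\<^sup>2 = sqrt (X\<^sup>2 + Y\<^sup>2)"
  by (simp add: complex_norm)

text \<open>The argument of \<open>w\<close> is at most a right angle in modulus, and the square
  root halves it.\<close>

lemma csqrt_sector:
  assumes "Re w \<ge> 0"
  shows "\<bar>Im (csqrt w)\<bar> \<le> Re (csqrt w)" "(cmod (csqrt w))\<^sup>2 \<le> 2 * (Re (csqrt w))\<^sup>2"
proof -
  show *: "\<bar>Im (csqrt w)\<bar> \<le> Re (csqrt w)"
    using assms complex_Re_le_cmod[of w] by (auto simp: abs_mult sgn_if)
  then have "(Im (csqrt w))\<^sup>2 \<le> (Re (csqrt w))\<^sup>2"
    by (metis abs_ge_zero power2_abs power_mono)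
  then show "(cmod (csqrt w))\<^sup>2 \<le> 2 * (Re (csqrt w))\<^sup>2" unfolding cmod_power2 by linarith
qed

lemma rho_robin:
  "rho \<nu> a b c \<omega> k p 0 0 = (p - symbol_root \<nu> a b c (\<omega>, k)) / (p + symbol_root \<nu> a b c (\<omega>, k))"
proof -
  have "complex_of_real (x0sq \<nu> a b) + complex_of_real (4 * \<nu>) *
      (complex_of_real (\<nu> * k\<^sup>2) + \<i> * complex_of_real (\<omega> + c * k))
    = Complex (x0sq \<nu> a b + 4 * \<nu>\<^sup>2 * k\<^sup>2) (4 * \<nu> * (\<omega> + c * k))"
    by (simp add: complex_eq_iff power2_eq_square)
  then show ?thesis by (simp add: rho_def symbol_root_def Let_def)
qed

lemma robin_sup_eq:
  "robin_sup \<nu> a b c quad Ch km \<omega>m h = robin_dev (symbol_root \<nu> a b c ` freq_dom quad Ch km \<omega>m h)"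
  by (simp add: fun_eq_iff robin_sup_def robin_dev_def rho_robin image_comp comp_def)

text \<open>Keeps the radicand off the branch cut: a nonzero \<open>k\<close> makes the real part
  positive, and for \<open>k = 0\<close> the imaginary part is
  \<open>4 * \<nu> * \<omega>\<close>.\<close>

lemma symbol_not_nonpos:
  fixes \<nu> \<omega> k :: real
  assumes "\<nu> > 0" "b \<ge> 0" "\<omega> \<noteq> 0"
  shows "x0sq \<nu> a b + 4 * \<nu>\<^sup>2 * k\<^sup>2 \<ge> 0"
    and "x0sq \<nu> a b + 4 * \<nu>\<^sup>2 * k\<^sup>2 \<noteq> 0 \<or> 4 * \<nu> * (\<omega> + c * k) \<noteq> 0"
proof -
  have x: "x0sq \<nu> a b \<ge> 0" using assms by (simp add: x0sq_def)
  show "x0sq \<nu> a b + 4 * \<nu>\<^sup>2 * k\<^sup>2 \<ge> 0" using x by simp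
  show "x0sq \<nu> a b + 4 * \<nu>\<^sup>2 * k\<^sup>2 \<noteq> 0 \<or> 4 * \<nu> * (\<omega> + c * k) \<noteq> 0"
  proof (cases "k = 0")
    case False
    then have "4 * \<nu>\<^sup>2 * k\<^sup>2 > 0" using assms by simp
    then show ?thesis using x by linarith
  qed (use assms in simp)
qed

lemma compact_symbol_roots:
  assumes "\<nu> > 0" "b \<ge> 0" "\<omega>m > 0"
  shows "compact (symbol_root \<nu> a b c ` freq_dom quad Ch km \<omega>m h)"
proof (rule compact_continuous_image)
  have "compact {x::real. l \<le> \<bar>x\<bar> \<and> \<bar>x\<bar> \<le> u}" for l u
  proof -
    have "{x::real. l \<le> \<bar>x\<bar> \<and> \<bar>x\<bar> \<le> u} = {x. l \<le> \<bar>x\<bar>} \<inter> {-u..u}" by auto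
    moreover have "closed {x::real. l \<le> \<bar>x\<bar>}" by (intro closed_Collect_le continuous_intros)
    ultimately show ?thesis by (simp add: closed_Int_compact)
  qed
  moreover have "freq_dom quad Ch km \<omega>m h = {\<omega>. \<omega>m \<le> \<bar>\<omega>\<bar> \<and> \<bar>\<omega>\<bar> \<le> pi / dt quad Ch h} \<times> {k. km \<le> \<bar>k\<bar> \<and> \<bar>k\<bar> \<le> pi / h}"
    by (auto simp: freq_dom_def)
  ultimately show "compact (freq_dom quad Ch km \<omega>m h)" by (simp add: compact_Times)
  show "continuous_on (freq_dom quad Ch km \<omega>m h) (symbol_root \<nu> a b c)"
    unfolding symbol_root_def case_prod_beta'
  proof (rule continuous_on_compose2[where g = csqrt and t = "- \<real>\<^sub>\<le>\<^sub>0"])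
    show "continuous_on (- \<real>\<^sub>\<le>\<^sub>0) csqrt" by (rule continuous_on_csqrt)
    show "continuous_on (freq_dom quad Ch km \<omega>m h)
      (\<lambda>x. Complex (x0sq \<nu> a b + 4 * \<nu>\<^sup>2 * (snd x)\<^sup>2) (4 * \<nu> * (fst x + c * snd x)))"
      unfolding Complex_eq by (intro continuous_intros)
    show "(\<lambda>x. Complex (x0sq \<nu> a b + 4 * \<nu>\<^sup>2 * (snd x)\<^sup>2) (4 * \<nu> * (fst x + c * snd x)))
      ` freq_dom quad Ch km \<omega>m h \<subseteq> - \<real>\<^sub>\<le>\<^sub>0"
    proof clarify
      fix \<omega> k
      let ?z = "Complex (x0sq \<nu> a b + 4 * \<nu>\<^sup>2 * (snd (\<omega>, k))\<^sup>2) (4 * \<nu> * (fst (\<omega>, k) + c * snd (\<omega>, k)))"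
      assume "(\<omega>, k) \<in> freq_dom quad Ch km \<omega>m h" and nonpos: "?z \<in> \<real>\<^sub>\<le>\<^sub>0"
      then have "\<omega> \<noteq> 0" using assms by (auto simp: freq_dom_def)
      note * = symbol_not_nonpos[OF assms(1,2) this, of a k]
      from *(1) *(2)[of c] nonpos show False unfolding complex_nonpos_Reals_iff by auto
    qed
  qed
qed

lemma symbol_root_properties:
  assumes "\<nu> > 0" "b \<ge> 0" "\<omega> \<noteq> 0"
  shows "Re (symbol_root \<nu> a b c (\<omega>, k)) = re_sqrt (x0sq \<nu> a b + 4 * \<nu>\<^sup>2 * k\<^sup>2) (4 * \<nu> * (\<omega> + c * k))"
    and "Re (symbol_root \<nu> a b c (\<omega>, k)) > 0"
    and "\<bar>Im (symbol_root \<nu> a b c (\<omega>, k))\<bar> \<le> Re (symbol_root \<nu> a b c (\<omega>, k))"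
    and "(cmod (symbol_root \<nu> a b c (\<omega>, k)))\<^sup>2 \<le> 2 * (Re (symbol_root \<nu> a b c (\<omega>, k)))\<^sup>2"
    and "cnj (symbol_root \<nu> a b c (\<omega>, k)) = symbol_root \<nu> a b c (- \<omega>, - k)"
    and "h > 0 \<Longrightarrow> h * (cmod (symbol_root \<nu> a b c (\<omega>, k)))\<^sup>2 =
      gain (h\<^sup>2 * (x0sq \<nu> a b + 4 * \<nu>\<^sup>2 * k\<^sup>2)) (h\<^sup>2 * (4 * \<nu> * (\<omega> + c * k))) * Re (symbol_root \<nu> a b c (\<omega>, k))"
proof -
  define X where "X = x0sq \<nu> a b + 4 * \<nu>\<^sup>2 * k\<^sup>2"
  define Y where "Y = 4 * \<nu> * (\<omega> + c * k)"
  have XY: "X \<ge> 0" "X \<noteq> 0 \<or> Y \<noteq> 0"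
    unfolding X_def Y_def using symbol_not_nonpos[OF assms, of a] by auto
  have z: "symbol_root \<nu> a b c (\<omega>, k) = csqrt (Complex X Y)" by (simp add: symbol_root_def X_def Y_def)
  have Re: "Re (symbol_root \<nu> a b c (\<omega>, k)) = re_sqrt X Y" unfolding z by (rule Re_csqrt_Complex)
  then show "Re (symbol_root \<nu> a b c (\<omega>, k)) = re_sqrt (x0sq \<nu> a b + 4 * \<nu>\<^sup>2 * k\<^sup>2) (4 * \<nu> * (\<omega> + c * k))"
    by (simp add: X_def Y_def)
  have pos: "re_sqrt X Y > 0" using XY by (rule re_sqrt_pos)
  then show "Re (symbol_root \<nu> a b c (\<omega>, k)) > 0" by (simp add: Re)
  show "\<bar>Im (symbol_root \<nu> a b c (\<omega>, k))\<bar> \<le> Re (symbol_root \<nu> a b c (\<omega>, k))"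
    "(cmod (symbol_root \<nu> a b c (\<omega>, k)))\<^sup>2 \<le> 2 * (Re (symbol_root \<nu> a b c (\<omega>, k)))\<^sup>2"
    unfolding z by (rule csqrt_sector; use XY in simp)+
  have neg: "symbol_root \<nu> a b c (- \<omega>, - k) = csqrt (Complex X (- Y))"
  proof -
    have "- Y = 4 * \<nu> * (- \<omega> + c * - k)" by (simp add: Y_def algebra_simps)
    then show ?thesis by (simp only: symbol_root_def X_def case_prod_conv power2_minus)
  qed
  have "cnj (csqrt (Complex X Y)) = csqrt (cnj (Complex X Y))"
    by (rule cnj_csqrt) (use XY in \<open>auto simp: complex_nonpos_Reals_iff\<close>)
  also have "cnj (Complex X Y) = Complex X (- Y)" by (simp add: complex_eq_iff)
  finally show "cnj (symbol_root \<nu> a b c (\<omega>, k)) = symbol_root \<nu> a b c (- \<omega>, - k)"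
    unfolding z neg .
  have "gain X Y * re_sqrt X Y = sqrt (X\<^sup>2 + Y\<^sup>2)" using pos by (simp add: gain_def)
  then show "h * (cmod (symbol_root \<nu> a b c (\<omega>, k)))\<^sup>2 =
      gain (h\<^sup>2 * (x0sq \<nu> a b + 4 * \<nu>\<^sup>2 * k\<^sup>2)) (h\<^sup>2 * (4 * \<nu> * (\<omega> + c * k))) * Re (symbol_root \<nu> a b c (\<omega>, k))"
    if "h > 0"
    unfolding X_def[symmetric] Y_def[symmetric] Re gain_scale[OF that] unfolding z cmod_csqrt_Complex by simp
qed

section \<open>Small mesh sizes: cut-offs, solvability and high frequencies\<close>

lemma freq_bounds_at_top:
  assumes "Ch > 0"
  shows "filterlim (\<lambda>h. pi / dt quad Ch h) at_top (at_right 0)"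
    and "filterlim (\<lambda>h::real. pi / h) at_top (at_right 0)"
proof -
  show "filterlim (\<lambda>h. pi / dt quad Ch h) at_top (at_right 0)"
    using assms by (cases quad) (simp_all add: dt_def, real_asymp+)
  show "filterlim (\<lambda>h::real. pi / h) at_top (at_right 0)" by real_asymp
qed

lemma eventually_freq_dom:
  assumes "Ch > 0" "\<omega>m \<le> \<bar>\<omega>\<bar>" "km \<le> \<bar>k\<bar>"
  shows "\<forall>\<^sub>F h in at_right 0. (\<omega>, k) \<in> freq_dom quad Ch km \<omega>m h"
proof -
  note lim = freq_bounds_at_top[OF assms(1)]
  have "\<forall>\<^sub>F h in at_right 0. \<bar>\<omega>\<bar> \<le> pi / dt quad Ch h" "\<forall>\<^sub>F h in at_right 0. \<bar>k\<bar> \<le> pi / h"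
    using lim by (auto simp: filterlim_at_top)
  then show ?thesis by eventually_elim (use assms in \<open>auto simp: freq_dom_def\<close>)
qed

lemma robin_solution:
  fixes a c :: real
  assumes "\<nu> > 0" "b \<ge> 0" "\<omega>m > 0" "(\<omega>m, km) \<in> freq_dom quad Ch km \<omega>m h"
  defines "K \<equiv> symbol_root \<nu> a b c ` freq_dom quad Ch km \<omega>m h"
  shows "\<exists>P \<delta>. robin_optimum K P \<delta>"
proof -
  define z where "z \<omega> = symbol_root \<nu> a b c (\<omega>, km)" for \<omega>
  have nz: "\<omega> \<noteq> 0" if "(\<omega>, k) \<in> freq_dom quad Ch km \<omega>m h" for \<omega> k
    using that assms(3) by (auto simp: freq_dom_def)
  have K: "compact K" unfolding K_def by (rule compact_symbol_roots[OF assms(1-3)])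
  have sec: "Re z > 0 \<and> \<bar>Im z\<bar> \<le> Re z" if "z \<in> K" for z
    using that symbol_root_properties(2,3)[OF assms(1,2) nz] unfolding K_def by auto
  have z: "z \<omega>m \<in> K" "z (- \<omega>m) \<in> K"
    using assms(4) unfolding K_def z_def by (auto simp: freq_dom_def intro!: imageI)
  \<comment> \<open>The imaginary parts of the two squares differ by
    \<open>8 * \<nu> * \<omega>m\<close>.\<close>
  have ne: "z \<omega>m \<noteq> z (- \<omega>m)"
  proof
    assume "z \<omega>m = z (- \<omega>m)"
    then have "Im ((z \<omega>m)\<^sup>2) = Im ((z (- \<omega>m))\<^sup>2)" by simp
    then show False using assms(1,3) by (simp add: z_def symbol_root_def)
  qed
  have cnj: "cnj z \<in> K" if zK: "z \<in> K" for z
  proof -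
    obtain \<omega> k where \<omega>k: "(\<omega>, k) \<in> freq_dom quad Ch km \<omega>m h" "z = symbol_root \<nu> a b c (\<omega>, k)"
      using zK unfolding K_def by auto
    then have "cnj z = symbol_root \<nu> a b c (- \<omega>, - k)"
      using symbol_root_properties(5)[OF assms(1,2) nz] by simp
    moreover have "(- \<omega>, - k) \<in> freq_dom quad Ch km \<omega>m h" using \<omega>k by (simp add: freq_dom_def)
    ultimately show ?thesis unfolding K_def by simp
  qed
  show ?thesis
    by (rule ex_robin_optimum[OF K _ z ne]) (use sec cnj in blast)+
qed

lemma high_frequency_bounds:
  fixes a c :: real and quad :: bool
  assumes "\<nu> > 0" "b \<ge> 0" "km \<ge> 0" "\<omega>m > 0" "Ch > 0"
  defines "K \<equiv> \<lambda>h. symbol_root \<nu> a b c ` freq_dom quad Ch km \<omega>m h"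
  obtains bu bl where "(bu \<longlongrightarrow> 4 / constB \<nu> quad Ch) (at_right 0)" "(bl \<longlongrightarrow> 4 / constB \<nu> quad Ch) (at_right 0)"
    "\<forall>\<^sub>F h in at_right 0. \<forall>z\<in>K h. h * (cmod z)\<^sup>2 \<le> bu h * Re z"
    "\<forall>\<^sub>F h in at_right 0. \<exists>z\<in>K h. bl h * Re z \<le> h * (cmod z)\<^sup>2"
proof -
  define r where "r h = h\<^sup>2 * (pi / dt quad Ch h)" for h
  define Y where "Y = (if quad then 4 * \<nu> * pi / Ch else 0)"
  define X where "X = 4 * \<nu>\<^sup>2 * pi\<^sup>2"
  define x where "x = x0sq \<nu> a b"
  have x: "x \<ge> 0" using assms by (simp add: x_def x0sq_def)
  have X: "X > 0" using assms by (simp add: X_def)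
  have Y: "Y \<ge> 0" using assms by (simp add: Y_def)
  have M: "max (sqrt (2 * Y)) (gain X Y) = 4 / constB \<nu> quad Ch"
    unfolding X_def Y_def by (rule constB_eq_gain[OF assms(1,5)])
  have h0: "\<forall>\<^sub>F h in at_right 0. (h::real) > 0" by (rule eventually_at_right_less)
  have r: "((\<lambda>h. 4 * \<nu> * (r h + c' * h)) \<longlongrightarrow> Y) (at_right 0)" for c'
  proof (cases quad)
    case True
    have "((\<lambda>h. 4 * \<nu> * (pi / Ch + c' * h)) \<longlongrightarrow> 4 * \<nu> * (pi / Ch + c' * 0)) (at_right 0)"
      by (intro tendsto_intros)
    moreover have "\<forall>\<^sub>F h in at_right 0. 4 * \<nu> * (pi / Ch + c' * h) = 4 * \<nu> * (r h + c' * h)"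
      using h0 by eventually_elim (simp add: r_def dt_def True)
    ultimately show ?thesis using True by (simp add: Y_def Lim_transform_eventually)
  next
    case False
    have "((\<lambda>h. 4 * \<nu> * (h * (pi / Ch) + c' * h)) \<longlongrightarrow> 4 * \<nu> * (0 * (pi / Ch) + c' * 0)) (at_right 0)"
      by (intro tendsto_intros)
    moreover have "\<forall>\<^sub>F h in at_right 0. 4 * \<nu> * (h * (pi / Ch) + c' * h) = 4 * \<nu> * (r h + c' * h)"
      using h0 by eventually_elim (simp add: r_def dt_def False power2_eq_square)
    ultimately show ?thesis using False by (simp add: Y_def Lim_transform_eventually)
  qed
  define X1 where "X1 h = h\<^sup>2 * x + X" for h
  \<comment> \<open>The drift \<open>c * k\<close> scales to at most
    \<open>\<bar>c\<bar> * pi * h\<close>, which vanishes in the limit, so only the time cut-off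
    contributes to \<open>Y\<close>.\<close>
  define Y1 where "Y1 h = 4 * \<nu> * (r h + (\<bar>c\<bar> * pi) * h)" for h
  define bu where "bu h = max (sqrt (2 * Y1 h)) (gain (X1 h) (Y1 h))" for h
  have "(X1 \<longlongrightarrow> 0\<^sup>2 * x + X) (at_right 0)" unfolding X1_def by (intro tendsto_intros)
  then have X1: "(X1 \<longlongrightarrow> X) (at_right 0)" by simp
  have Y1: "(Y1 \<longlongrightarrow> Y) (at_right 0)" unfolding Y1_def by (rule r)
  have bu: "(bu \<longlongrightarrow> 4 / constB \<nu> quad Ch) (at_right 0)"
    unfolding bu_def M[symmetric] by (intro tendsto_intros tendsto_gain X1 Y1) (use X in auto)
  have upper: "\<forall>\<^sub>F h in at_right 0. \<forall>z\<in>K h. h * (cmod z)\<^sup>2 \<le> bu h * Re z"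
    using h0
  proof eventually_elim
    case (elim h)
    show ?case
    proof
      fix z assume "z \<in> K h"
      then obtain \<omega> k where D: "(\<omega>, k) \<in> freq_dom quad Ch km \<omega>m h" and z: "z = symbol_root \<nu> a b c (\<omega>, k)"
        unfolding K_def by auto
      have nz: "\<omega> \<noteq> 0" using D assms(4) by (auto simp: freq_dom_def)
      define X' where "X' = h\<^sup>2 * (x + 4 * \<nu>\<^sup>2 * k\<^sup>2)"
      define Y' where "Y' = h\<^sup>2 * (4 * \<nu> * (\<omega> + c * k))"
      have dt: "dt quad Ch h > 0" using elim assms by (simp add: dt_def)
      have hk: "h * \<bar>k\<bar> \<le> pi" using D elim by (simp add: freq_dom_def field_simps)
      then have "(h * \<bar>k\<bar>)\<^sup>2 \<le> pi\<^sup>2" using elim by (intro power_mono) auto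
      then have "4 * \<nu>\<^sup>2 * (h * \<bar>k\<bar>)\<^sup>2 \<le> 4 * \<nu>\<^sup>2 * pi\<^sup>2" by (intro mult_left_mono) auto
      then have X': "0 \<le> X'" "X' \<le> X1 h"
        using x by (auto simp: X'_def X1_def X_def power_mult_distrib algebra_simps)
      have "h\<^sup>2 * \<bar>\<omega>\<bar> \<le> r h" unfolding r_def using D by (intro mult_left_mono) (auto simp: freq_dom_def)
      moreover have "h\<^sup>2 * (\<bar>c\<bar> * \<bar>k\<bar>) \<le> (\<bar>c\<bar> * pi) * h"
        using mult_left_mono[OF hk, of "\<bar>c\<bar> * h"] elim by (simp add: power2_eq_square algebra_simps)
      moreover have "h\<^sup>2 * \<bar>\<omega> + c * k\<bar> \<le> h\<^sup>2 * (\<bar>\<omega>\<bar> + \<bar>c\<bar> * \<bar>k\<bar>)"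
        by (intro mult_left_mono) (auto simp: abs_mult[symmetric] abs_triangle_ineq)
      ultimately have "h\<^sup>2 * \<bar>\<omega> + c * k\<bar> \<le> r h + (\<bar>c\<bar> * pi) * h" by (simp add: distrib_left)
      then have "4 * \<nu> * (h\<^sup>2 * \<bar>\<omega> + c * k\<bar>) \<le> Y1 h" unfolding Y1_def using assms by simp
      moreover have "\<bar>Y'\<bar> = 4 * \<nu> * (h\<^sup>2 * \<bar>\<omega> + c * k\<bar>)" using assms(1) by (simp add: Y'_def abs_mult)
      ultimately have Y': "\<bar>Y'\<bar> \<le> Y1 h" by simp
      have Y1: "Y1 h > 0" unfolding Y1_def r_def using dt elim assms
        by (intro mult_pos_pos add_pos_nonneg) auto
      have "gain X' Y' \<le> gain X' (Y1 h)" by (rule gain_mono_right[OF X'(1) Y'])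
      also have "\<dots> \<le> max (gain 0 (Y1 h)) (gain (X1 h) (Y1 h))" by (rule gain_le_max[OF X' Y1])
      also have "\<dots> = bu h" using Y1 by (simp add: bu_def gain_zero_left)
      finally have "gain X' Y' * Re z \<le> bu h * Re z"
        using symbol_root_properties(2)[OF assms(1,2) nz, of a c k] unfolding z
        by (intro mult_right_mono) auto
      then show "h * (cmod z)\<^sup>2 \<le> bu h * Re z"
        using symbol_root_properties(6)[OF assms(1,2) nz elim, of a c k] unfolding z X'_def Y'_def x_def by simp
    qed
  qed
  note lim = freq_bounds_at_top[OF assms(5)]
  have big: "\<forall>\<^sub>F h in at_right 0. max 1 \<omega>m \<le> pi / dt quad Ch h" "\<forall>\<^sub>F h in at_right 0. max 1 km \<le> pi / h"
    using lim unfolding filterlim_at_top by blast+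
  show thesis
  \<comment> \<open>The larger candidate dictates the witness at the time cut-off: the spatial
    cut-off \<open>pi / h\<close>, or the fixed \<open>km\<close>, whose scaled real part tends to
    0. The second case forces \<open>Y > 0\<close>, hence quadratic time steps.\<close>
  proof (cases "sqrt (2 * Y) \<le> gain X Y")
    case True
    define bl where "bl h = gain (X1 h) (4 * \<nu> * (r h + (c * pi) * h))" for h
    have "(bl \<longlongrightarrow> gain X Y) (at_right 0)"
      unfolding bl_def by (intro tendsto_gain X1 r) (use X in auto)
    then have bl: "(bl \<longlongrightarrow> 4 / constB \<nu> quad Ch) (at_right 0)" using True M by (simp add: max_def)
    have lower: "\<forall>\<^sub>F h in at_right 0. \<exists>z\<in>K h. bl h * Re z \<le> h * (cmod z)\<^sup>2"
      using h0 big
    proof eventually_elim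
      case (elim h)
      have nz: "pi / dt quad Ch h \<noteq> 0" using elim by linarith
      have dt: "dt quad Ch h > 0" using elim(1) assms(5) by (simp add: dt_def)
      have D: "(pi / dt quad Ch h, pi / h) \<in> freq_dom quad Ch km \<omega>m h"
        using elim dt unfolding freq_dom_def by auto
      have "h\<^sup>2 * (x + 4 * \<nu>\<^sup>2 * (pi / h)\<^sup>2) = X1 h"
        using elim by (simp add: X1_def X_def field_simps)
      moreover have "h\<^sup>2 * (4 * \<nu> * (pi / dt quad Ch h + c * (pi / h))) = 4 * \<nu> * (r h + (c * pi) * h)"
        using elim(1) by (simp add: r_def field_simps power2_eq_square)
      ultimately have "gain (h\<^sup>2 * (x + 4 * \<nu>\<^sup>2 * (pi / h)\<^sup>2)) (h\<^sup>2 * (4 * \<nu> * (pi / dt quad Ch h + c * (pi / h)))) = bl h"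
        by (simp only: bl_def)
      then have "h * (cmod (symbol_root \<nu> a b c (pi / dt quad Ch h, pi / h)))\<^sup>2
          = bl h * Re (symbol_root \<nu> a b c (pi / dt quad Ch h, pi / h))"
        using symbol_root_properties(6)[OF assms(1,2) nz elim(1), of a c "pi / h"] by (simp only: x_def)
      then show ?case using D unfolding K_def by (intro bexI[OF _ imageI[OF D]]) simp
    qed
    show ?thesis by (rule that[OF bu bl upper lower])
  next
    case False
    have Y0: "Y > 0"
    proof (rule ccontr)
      assume "\<not> Y > 0"
      then show False using False Y X by (simp add: gain_zero_right)
    qed
    define bl where "bl h = gain (h\<^sup>2 * (x + 4 * \<nu>\<^sup>2 * km\<^sup>2)) (4 * \<nu> * (r h + (c * km * h) * h))" for h
    have "((\<lambda>h. h\<^sup>2 * (x + 4 * \<nu>\<^sup>2 * km\<^sup>2)) \<longlongrightarrow> 0\<^sup>2 * (x + 4 * \<nu>\<^sup>2 * km\<^sup>2)) (at_right 0)"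
      by (intro tendsto_intros)
    then have Xl: "((\<lambda>h. h\<^sup>2 * (x + 4 * \<nu>\<^sup>2 * km\<^sup>2)) \<longlongrightarrow> 0) (at_right 0)" by simp
    have "((\<lambda>h. 4 * \<nu> * (r h + 0 * h) + 4 * \<nu> * (c * km * h * h)) \<longlongrightarrow> Y + 4 * \<nu> * (c * km * 0 * 0)) (at_right 0)"
      by (intro tendsto_add[OF r] tendsto_intros)
    then have Yl: "((\<lambda>h. 4 * \<nu> * (r h + (c * km * h) * h)) \<longlongrightarrow> Y) (at_right 0)"
      by (simp add: distrib_left)
    have "(bl \<longlongrightarrow> gain 0 Y) (at_right 0)"
      unfolding bl_def by (intro tendsto_gain Xl Yl) (use Y0 in auto)
    then have bl: "(bl \<longlongrightarrow> 4 / constB \<nu> quad Ch) (at_right 0)"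
      using False M Y by (simp add: max_def gain_zero_left)
    have lower: "\<forall>\<^sub>F h in at_right 0. \<exists>z\<in>K h. bl h * Re z \<le> h * (cmod z)\<^sup>2"
      using h0 big
    proof eventually_elim
      case (elim h)
      have nz: "pi / dt quad Ch h \<noteq> 0" using elim by linarith
      have dt: "dt quad Ch h > 0" using elim(1) assms(5) by (simp add: dt_def)
      have D: "(pi / dt quad Ch h, km) \<in> freq_dom quad Ch km \<omega>m h"
        using elim assms(3) dt unfolding freq_dom_def by auto
      have "h\<^sup>2 * (4 * \<nu> * (pi / dt quad Ch h + c * km)) = 4 * \<nu> * (r h + (c * km * h) * h)"
        by (simp add: r_def algebra_simps power2_eq_square)
      then have "gain (h\<^sup>2 * (x + 4 * \<nu>\<^sup>2 * km\<^sup>2)) (h\<^sup>2 * (4 * \<nu> * (pi / dt quad Ch h + c * km))) = bl h"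
        by (simp only: bl_def)
      then have "h * (cmod (symbol_root \<nu> a b c (pi / dt quad Ch h, km)))\<^sup>2
          = bl h * Re (symbol_root \<nu> a b c (pi / dt quad Ch h, km))"
        using symbol_root_properties(6)[OF assms(1,2) nz elim(1), of a c km] by (simp only: x_def)
      then show ?case using D unfolding K_def by (intro bexI[OF _ imageI[OF D]]) simp
    qed
    show ?thesis by (rule that[OF bu bl upper lower])
  qed
qed

theorem theorem1:
  fixes \<nu> b a c km \<omega>m Ch :: real and quad :: bool
  assumes "\<nu> > 0" and "b \<ge> 0" and "km \<ge> 0" and "\<omega>m > 0" and "Ch > 0"
  shows "(\<forall>\<^sub>F h in at_right 0.
            \<exists>!p. robin_sup \<nu> a b c quad Ch km \<omega>m h p
                   = (INF p'. robin_sup \<nu> a b c quad Ch km \<omega>m h p'))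
       \<and> ((\<lambda>h. (THE p. robin_sup \<nu> a b c quad Ch km \<omega>m h p
                       = (INF p'. robin_sup \<nu> a b c quad Ch km \<omega>m h p'))
               / complex_of_real (sqrt (constA \<nu> a b c km \<omega>m / (constB \<nu> quad Ch * h))))
           \<longlongrightarrow> 1) (at_right 0)
       \<and> ((\<lambda>h. (1 - real_of_ereal (INF p. robin_sup \<nu> a b c quad Ch km \<omega>m h p))
               / (1 / 2 * sqrt (constA \<nu> a b c km \<omega>m * constB \<nu> quad Ch * h)))
           \<longlongrightarrow> 1) (at_right 0)"
proof -
  define A where "A = constA \<nu> a b c km \<omega>m"
  define B where "B = constB \<nu> quad Ch"
  define K where "K h = symbol_root \<nu> a b c ` freq_dom quad Ch km \<omega>m h" for h
  have h0: "\<forall>\<^sub>F h in at_right 0. (h::real) > 0" by (rule eventually_at_right_less)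
  obtain \<omega>0 k0 where \<omega>0: "\<omega>m \<le> \<bar>\<omega>0\<bar>" "km \<le> \<bar>k0\<bar>"
    "re_sqrt (x0sq \<nu> a b + 4 * \<nu>\<^sup>2 * k0\<^sup>2) (4 * \<nu> * (\<omega>0 + c * k0)) = A / 4"
    unfolding A_def by (rule constA_attained[OF assms(1-4)])
  have nz: "\<omega>0 \<noteq> 0" using \<omega>0 assms(4) by auto
  have "A / 4 > 0"
    using symbol_root_properties(1,2)[OF assms(1,2) nz, of a c k0] unfolding \<omega>0(3) by simp
  then have A: "A > 0" by simp
  have "gain (4 * \<nu>\<^sup>2 * pi\<^sup>2) y > 0" for y
    unfolding gain_def using assms(1) by (intro divide_pos_pos re_sqrt_pos) (auto simp: add_pos_nonneg)
  then have "4 / B > 0"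
    unfolding B_def constB_eq_gain[OF assms(1,5), symmetric] by (simp add: less_max_iff_disj)
  then have B: "B > 0" by (simp add: zero_less_divide_iff)
  define good where "good h \<longleftrightarrow> (\<omega>m, km) \<in> freq_dom quad Ch km \<omega>m h" for h
  have good: "\<forall>\<^sub>F h in at_right 0. good h"
    unfolding good_def by (rule eventually_freq_dom) (use assms in auto)
  \<comment> \<open>Choice for every \<open>h\<close>; the values where \<open>good\<close> fails
    are arbitrary and do not affect the limit.\<close>
  have "\<forall>h. \<exists>P \<delta>. good h \<longrightarrow> robin_optimum (K h) P \<delta>"
    using robin_solution[OF assms(1,2,4)] unfolding K_def good_def by blast
  then obtain P \<delta> where sol: "\<And>h. good h \<Longrightarrow> robin_optimum (K h) (P h) (\<delta> h)"
    unfolding choice_iff by blast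
  then have unique: "\<And>h p. good h \<Longrightarrow> robin_dev (K h) p = (INF p'. robin_dev (K h) p') \<longleftrightarrow> p = complex_of_real (P h)"
    and val: "\<And>h. good h \<Longrightarrow> (INF p. robin_dev (K h) p) = ereal (\<delta> h)"
    unfolding robin_optimum_def by blast+
  obtain bu bl where bu: "(bu \<longlongrightarrow> 4 / B) (at_right 0)" and bl: "(bl \<longlongrightarrow> 4 / B) (at_right 0)"
    and upper: "\<forall>\<^sub>F h in at_right 0. \<forall>z\<in>K h. h * (cmod z)\<^sup>2 \<le> bu h * Re z"
    and lower: "\<forall>\<^sub>F h in at_right 0. \<exists>z\<in>K h. bl h * Re z \<le> h * (cmod z)\<^sup>2"
    unfolding K_def B_def by (rule high_frequency_bounds[OF assms])
  have K: "A / 4 \<le> Re z \<and> (cmod z)\<^sup>2 \<le> 2 * (Re z)\<^sup>2" if "z \<in> K h" for z h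
  proof -
    obtain \<omega> k where D: "(\<omega>, k) \<in> freq_dom quad Ch km \<omega>m h" and z: "z = symbol_root \<nu> a b c (\<omega>, k)"
      using \<open>z \<in> K h\<close> unfolding K_def by auto
    then have "\<omega>m \<le> \<bar>\<omega>\<bar>" "km \<le> \<bar>k\<bar>" "\<omega> \<noteq> 0" using assms(4) by (auto simp: freq_dom_def)
    then show ?thesis
      using symbol_root_properties(1,4)[OF assms(1,2), of \<omega> a c k]
        constA_le_re_sqrt[OF assms(1-4), of \<omega> k a c] by (simp add: z A_def)
  qed
  \<comment> \<open>With \<open>m = A / 4\<close> and \<open>M = 4 / B\<close> one gets
    \<open>m * M = A / B\<close> and \<open>2 * sqrt (m / M) = 1 / 2 * sqrt (A * B)\<close>, the two
    claimed constants.\<close>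
  have lims: "((\<lambda>h. P h * sqrt h) \<longlongrightarrow> sqrt (A / 4 * (4 / B))) (at_right 0)"
    "((\<lambda>h. (1 - \<delta> h) / sqrt h) \<longlongrightarrow> 2 * sqrt (A / 4 / (4 / B))) (at_right 0)"
  proof -
    have ev: "\<forall>\<^sub>F h in at_right 0. robin_optimum (K h) (P h) (\<delta> h)"
      using good by eventually_elim (rule sol)
    have "\<forall>\<^sub>F h in at_right 0. \<forall>z\<in>K h. A / 4 \<le> Re z \<and> (cmod z)\<^sup>2 \<le> 2 * (Re z)\<^sup>2 \<and> h * (cmod z)\<^sup>2 \<le> bu h * Re z"
      using upper by eventually_elim (use K in blast)
    moreover have "\<forall>\<^sub>F h in at_right 0. \<exists>z\<in>K h. Re z = A / 4"
      using eventually_freq_dom[OF assms(5) \<omega>0(1,2), of quad]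
    proof eventually_elim
      case (elim h)
      have "Re (symbol_root \<nu> a b c (\<omega>0, k0)) = A / 4"
        using symbol_root_properties(1)[OF assms(1,2) nz, of a c k0] \<omega>0(3) by simp
      then show ?case unfolding K_def using elim by blast
    qed
    ultimately show "((\<lambda>h. P h * sqrt h) \<longlongrightarrow> sqrt (A / 4 * (4 / B))) (at_right 0)"
      "((\<lambda>h. (1 - \<delta> h) / sqrt h) \<longlongrightarrow> 2 * sqrt (A / 4 / (4 / B))) (at_right 0)"
      using robin_asymptotics[OF \<open>A / 4 > 0\<close> \<open>4 / B > 0\<close> bu bl ev _ _ lower] by blast+
  qed
  have S: "robin_sup \<nu> a b c quad Ch km \<omega>m h = robin_dev (K h)" for h
    by (simp add: robin_sup_eq K_def)
  have "\<forall>\<^sub>F h in at_right 0. \<exists>!p. robin_dev (K h) p = (INF p'. robin_dev (K h) p')"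
    using good by eventually_elim (simp add: unique)
  moreover have "((\<lambda>h. (THE p. robin_dev (K h) p = (INF p'. robin_dev (K h) p'))
      / complex_of_real (sqrt (A / (B * h)))) \<longlongrightarrow> 1) (at_right 0)"
  proof (rule Lim_transform_eventually)
    have "((\<lambda>h. complex_of_real (P h * sqrt h / sqrt (A / B))) \<longlongrightarrow> of_real (sqrt (A / B) / sqrt (A / B))) (at_right 0)"
      using lims(1) A B by (intro tendsto_intros) auto
    then show "((\<lambda>h. complex_of_real (P h * sqrt h / sqrt (A / B))) \<longlongrightarrow> 1) (at_right 0)"
      using A B by simp
    show "\<forall>\<^sub>F h in at_right 0. complex_of_real (P h * sqrt h / sqrt (A / B)) =
      (THE p. robin_dev (K h) p = (INF p'. robin_dev (K h) p')) / complex_of_real (sqrt (A / (B * h)))"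
      using good h0
    proof eventually_elim
      case (elim h)
      have "(THE p. robin_dev (K h) p = (INF p'. robin_dev (K h) p')) = complex_of_real (P h)"
        by (simp add: unique[OF elim(1)])
      moreover have "P h * sqrt h / sqrt (A / B) = P h / sqrt (A / (B * h))"
        using elim(2) by (simp add: real_sqrt_divide real_sqrt_mult)
      ultimately show ?case by simp
    qed
  qed
  moreover have "((\<lambda>h. (1 - real_of_ereal (INF p. robin_dev (K h) p)) / (1 / 2 * sqrt (A * B * h))) \<longlongrightarrow> 1) (at_right 0)"
  proof (rule Lim_transform_eventually)
    have eq: "2 * sqrt (A / 4 / (4 / B)) = 1 / 2 * sqrt (A * B)"
      using A B real_sqrt_abs[of 4] by (simp add: real_sqrt_divide)
    have "((\<lambda>h. (1 - \<delta> h) / sqrt h / (1 / 2 * sqrt (A * B))) \<longlongrightarrow> 1 / 2 * sqrt (A * B) / (1 / 2 * sqrt (A * B))) (at_right 0)"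
      using A B by (intro tendsto_divide[OF lims(2)[unfolded eq]] tendsto_const) auto
    then show "((\<lambda>h. (1 - \<delta> h) / sqrt h / (1 / 2 * sqrt (A * B))) \<longlongrightarrow> 1) (at_right 0)"
      using A B by simp
    show "\<forall>\<^sub>F h in at_right 0. (1 - \<delta> h) / sqrt h / (1 / 2 * sqrt (A * B)) =
      (1 - real_of_ereal (INF p. robin_dev (K h) p)) / (1 / 2 * sqrt (A * B * h))"
      using good h0
    proof eventually_elim
      case (elim h)
      have "real_of_ereal (INF p. robin_dev (K h) p) = \<delta> h" by (simp add: val[OF elim(1)])
      then show ?case by (simp add: real_sqrt_mult)
    qed
  qed
  ultimately show ?thesis unfolding S A_def B_def by blast
qed

end
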